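(* Let $K$ be a field, let $m, \ell \in \mathbb{N}$ and let $E$ be the natural $2$-dimensional representation of $\mathrm{GL}_2(K)$. Then there is an isomorphism of representations of $\mathrm{GL}_2(K)$ $$\mathrm{Sym}_m \mathrm{Sym}^\ell E \cong \mathrm{Sym}^\ell \mathrm{Sym}_m E.$$
   Context: For a $K$-vector space $V$, the symmetric group $S_r$ acts on $V^{\otimes r}$ by place permutation. $\mathrm{Sym}_r V=(V^{\otimes r})^{S_r}$ is the space of invariants, and $\mathrm{Sym}^r V$ is the usual symmetric power (coinvariants: the quotient of $V^{\otimes r}$ by the span of all $w\cdot\sigma-w$, $w\in V^{\otimes r}$, $\sigma\in S_r$). *)

theory Defs
  imports
    "Jordan_Normal_Form.VS_Connect"
    "HOL-Algebra.AbelCoset"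
    "HOL-Algebra.Group_Action"
    "HOL-Combinatorics.Permutations"
begin

definition quot_module ::
    "('k, 'v, 'm) module_scheme \<Rightarrow> 'v set \<Rightarrow> ('k, 'v set) module" where
  "quot_module M N =
     \<lparr>carrier = a_rcosets\<^bsub>M\<^esub> N,
      mult = undefined,
      one = undefined,
      zero = N,
      add = (\<lambda>X Y. X <+>\<^bsub>M\<^esub> Y),
      smult = (\<lambda>a X. \<Union>x\<in>X. N +>\<^bsub>M\<^esub> (a \<odot>\<^bsub>M\<^esub> x))\<rparr>"

text \<open>The map induced on \<open>M / N\<close> by an endomorphism \<open>f\<close> of \<open>M\<close> with \<open>f ` N \<subseteq> N\<close>.\<close>

definition quot_map ::
    "('k, 'v, 'm) module_scheme \<Rightarrow> 'v set \<Rightarrow> ('v \<Rightarrow> 'v) \<Rightarrow> 'v set \<Rightarrow> 'v set" where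
  "quot_map M N f = (\<lambda>X \<in> carrier (quot_module M N). \<Union>x\<in>X. N +>\<^bsub>M\<^esub> f x)"

definition tuples :: "('k, 'v, 'm) module_scheme \<Rightarrow> nat \<Rightarrow> 'v list set" where
  "tuples V r = {xs. length xs = r \<and> set xs \<subseteq> carrier V}"

text \<open>The free \<open>K\<close>-module on the \<open>r\<close>-tuples of elements of \<open>V\<close>: finitely supported functions,
  extended by zero to all lists.\<close>

definition free_tuples ::
    "('k, 'a) ring_scheme \<Rightarrow> ('k, 'v, 'm) module_scheme \<Rightarrow> nat \<Rightarrow> ('k, 'v list \<Rightarrow> 'k) module" where
  "free_tuples K V r =
     \<lparr>carrier = {f. range f \<subseteq> carrier K \<and> finite {xs. f xs \<noteq> \<zero>\<^bsub>K\<^esub>} \<and>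
                    {xs. f xs \<noteq> \<zero>\<^bsub>K\<^esub>} \<subseteq> tuples V r},
      mult = undefined,
      one = undefined,
      zero = (\<lambda>xs. \<zero>\<^bsub>K\<^esub>),
      add = (\<lambda>f g xs. f xs \<oplus>\<^bsub>K\<^esub> g xs),
      smult = (\<lambda>a f xs. a \<otimes>\<^bsub>K\<^esub> f xs)\<rparr>"

definition tuple_basis :: "('k, 'a) ring_scheme \<Rightarrow> 'v list \<Rightarrow> 'v list \<Rightarrow> 'k" where
  "tuple_basis K xs = (\<lambda>ys. if ys = xs then \<one>\<^bsub>K\<^esub> else \<zero>\<^bsub>K\<^esub>)"

definition multilin_rels ::
    "('k, 'a) ring_scheme \<Rightarrow> ('k, 'v, 'm) module_scheme \<Rightarrow> nat \<Rightarrow> ('v list \<Rightarrow> 'k) set" where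
  "multilin_rels K V r = (let F = free_tuples K V r; b = tuple_basis K in
     {b (xs[i := x \<oplus>\<^bsub>V\<^esub> y]) \<ominus>\<^bsub>F\<^esub> (b (xs[i := x]) \<oplus>\<^bsub>F\<^esub> b (xs[i := y])) | xs i x y.
        xs \<in> tuples V r \<and> i < r \<and> x \<in> carrier V \<and> y \<in> carrier V} \<union>
     {b (xs[i := a \<odot>\<^bsub>V\<^esub> x]) \<ominus>\<^bsub>F\<^esub> a \<odot>\<^bsub>F\<^esub> b (xs[i := x]) | xs i a x.
        xs \<in> tuples V r \<and> i < r \<and> a \<in> carrier K \<and> x \<in> carrier V})"

definition tensor_kernel ::
    "('k, 'a) ring_scheme \<Rightarrow> ('k, 'v, 'm) module_scheme \<Rightarrow> nat \<Rightarrow> ('v list \<Rightarrow> 'k) set" where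
  "tensor_kernel K V r =
     LinearCombinations.module.span K (free_tuples K V r) (multilin_rels K V r)"

text \<open>\<open>V\<^sup>\<otimes>\<^sup>r\<close>; the pure tensor of a tuple \<open>xs\<close> is the coset of \<open>tuple_basis K xs\<close>.\<close>

definition tensor_power ::
    "('k, 'a) ring_scheme \<Rightarrow> nat \<Rightarrow> ('k, 'v, 'm) module_scheme \<Rightarrow> ('k, ('v list \<Rightarrow> 'k) set) module" where
  "tensor_power K r V = quot_module (free_tuples K V r) (tensor_kernel K V r)"

text \<open>The endomorphism of \<open>V\<^sup>\<otimes>\<^sup>r\<close> determined by a map \<open>\<phi>\<close> on \<open>r\<close>-tuples that respects the
  multilinear relations: extend \<open>\<phi>\<close> linearly to the free module and pass to the quotient.\<close>

definition tensor_map ::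
    "('k, 'a) ring_scheme \<Rightarrow> nat \<Rightarrow> ('k, 'v, 'm) module_scheme \<Rightarrow> ('v list \<Rightarrow> 'v list) \<Rightarrow>
      ('v list \<Rightarrow> 'k) set \<Rightarrow> ('v list \<Rightarrow> 'k) set" where
  "tensor_map K r V \<phi> = (let F = free_tuples K V r in
     quot_map F (tensor_kernel K V r)
       (\<lambda>f. \<Oplus>\<^bsub>F\<^esub> xs \<in> {xs. f xs \<noteq> \<zero>\<^bsub>K\<^esub>}. f xs \<odot>\<^bsub>F\<^esub> tuple_basis K (\<phi> xs)))"

text \<open>Place permutation, a right action of \<open>S\<^sub>r\<close>: the \<open>i\<close>-th factor of
  \<open>(v\<^sub>0 \<otimes> \<dots> \<otimes> v\<^sub>r\<^sub>-\<^sub>1)\<cdot>\<sigma>\<close> is \<open>v\<^bsub>\<sigma> i\<^esub>\<close>.\<close>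

definition place_perm ::
    "('k, 'a) ring_scheme \<Rightarrow> nat \<Rightarrow> ('k, 'v, 'm) module_scheme \<Rightarrow> (nat \<Rightarrow> nat) \<Rightarrow>
      ('v list \<Rightarrow> 'k) set \<Rightarrow> ('v list \<Rightarrow> 'k) set" where
  "place_perm K r V \<sigma> = tensor_map K r V (permute_list \<sigma>)"

locale linear_representation =
  V?: vectorspace K V + act?: group_action G "carrier V" \<rho>
  for K and V and G and \<rho> +
  assumes action_linear: "g \<in> carrier G \<Longrightarrow> \<rho> g \<in> LinearCombinations.module_hom K V V"

text \<open>A representation is passed around as a pair of its underlying module and its action. As
  required by \<^locale>\<open>group_action\<close>, the action is restricted to the carrier of the module.\<close>

type_synonym ('k, 'v, 'g) rep = "('k, 'v) module \<times> ('g \<Rightarrow> 'v \<Rightarrow> 'v)"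

definition rep_isomorphic ::
    "('k, 'a) ring_scheme \<Rightarrow> ('g, 'b) monoid_scheme \<Rightarrow>
      ('k, 'v, 'g) rep \<Rightarrow> ('k, 'w, 'g) rep \<Rightarrow> bool" where
  "rep_isomorphic K G = (\<lambda>(V, \<rho>) (W, \<tau>).
     linear_representation K V G \<rho> \<and> linear_representation K W G \<tau> \<and>
     (\<exists>f \<in> LinearCombinations.module_hom K V W. bij_betw f (carrier V) (carrier W) \<and>
        (\<forall>g \<in> carrier G. \<forall>v \<in> carrier V. f (\<rho> g v) = \<tau> g (f v))))"

definition tensor_rep ::
    "('k, 'a) ring_scheme \<Rightarrow> nat \<Rightarrow> ('k, 'v, 'g) rep \<Rightarrow> ('k, ('v list \<Rightarrow> 'k) set, 'g) rep" where
  "tensor_rep K r = (\<lambda>(V, \<rho>). (tensor_power K r V, \<lambda>g. tensor_map K r V (map (\<rho> g))))"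

definition Sym_lower ::
    "('k, 'a) ring_scheme \<Rightarrow> nat \<Rightarrow> ('k, 'v, 'g) rep \<Rightarrow> ('k, ('v list \<Rightarrow> 'k) set, 'g) rep" where
  "Sym_lower K r = (\<lambda>(V, \<rho>). let (T, \<tau>) = tensor_rep K r (V, \<rho>);
       I = {w \<in> carrier T. \<forall>\<sigma>. \<sigma> permutes {..<r} \<longrightarrow> place_perm K r V \<sigma> w = w}
     in (T\<lparr>carrier := I\<rparr>, \<lambda>g. restrict (\<tau> g) I))"

definition Sym_upper ::
    "('k, 'a) ring_scheme \<Rightarrow> nat \<Rightarrow> ('k, 'v, 'g) rep \<Rightarrow> ('k, ('v list \<Rightarrow> 'k) set set, 'g) rep" where
  "Sym_upper K r = (\<lambda>(V, \<rho>). let (T, \<tau>) = tensor_rep K r (V, \<rho>);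
       N = LinearCombinations.module.span K T
             {place_perm K r V \<sigma> w \<ominus>\<^bsub>T\<^esub> w | \<sigma> w. \<sigma> permutes {..<r} \<and> w \<in> carrier T}
     in (quot_module T N, \<lambda>g. quot_map T N (\<tau> g)))"

definition GL :: "'k::field itself \<Rightarrow> nat \<Rightarrow> 'k mat monoid" where
  "GL k n = units_of (ring_mat k n ())"

definition natural_rep :: "'k::field itself \<Rightarrow> nat \<Rightarrow> ('k, 'k vec, 'k mat) rep" where
  "natural_rep k n = (module_vec k n, \<lambda>A. \<lambda>v \<in> carrier_vec n. A *\<^sub>v v)"

end

theory Submission
  imports Defs "HOL-Computational_Algebra.Polynomial"
begin

text \<open>Both sides are realised as spaces of functions of \<open>m\<close> points \<open>(x\<^sub>i, y\<^sub>i)\<close>. An element of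
  \<open>Sym\<^sub>m Sym\<^sup>l E\<close> becomes a symmetric function, homogeneous of degree \<open>l\<close> in each point; an element of
  \<open>Sym\<^sub>m E\<close> becomes a symmetric function of degree 1 in each point, and a product of \<open>l\<close> such elements in
  \<open>Sym\<^sup>l Sym\<^sub>m E\<close> is sent to the product of the functions. That the two spaces of functions agree, and that
  no information is lost, is the homogenised fundamental theorem of symmetric polynomials: symmetric
  polynomials of degree at most \<open>l\<close> in each variable have the products of \<open>l\<close> elementary symmetric
  polynomials \<open>e\<^sub>0, \<dots>, e\<^sub>m\<close> as a basis. The group acts on the points, so the comparison is equivariant.

  As \<open>K\<close> may be finite, the coordinates of the points range over \<open>K[X]\<close>. At the Kronecker point
  \<open>x\<^sub>i = X^(N^i)\<close>, \<open>y\<^sub>i = 1\<close> distinct monomials take values of distinct degrees, so linear independence and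
  the leading-term argument reduce to comparing degrees of univariate polynomials.\<close>

section \<open>Vector spaces, spans and quotients\<close>

text \<open>The correspondence is not given by a formula. Two elements are matched when they define
  the same function of the points; matching respects linear combinations, generators of each side
  have partners on the other, and the value at the single Kronecker point determines an element. So
  matching is the graph of a linear bijection, with neither a dimension count nor a well-definedness
  check on generators. One point suffices to separate elements, but the group moves it to points of
  another shape; agreement must therefore be known at all points.

  The two halves of the fundamental theorem serve different sides: spanning, by leading-term
  elimination, describes the invariants, and independence makes evaluation injective on the
  quotient. No factorial is ever divided by. The elementary symmetric functions have top coefficient
  1 at the Kronecker point, so the comparison of degrees is the same in every characteristic,
  including those where invariants and coinvariants of a tensor power are different
  representations.\<close>

locale kspace =
  fixes V :: "('k::field, 'v, 'm) module_scheme" (structure)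
  assumes vs: "vectorspace (class_ring :: 'k ring) V"
begin

lemma module: "module (class_ring :: 'k ring) V"
  using vs by (simp add: vectorspace_def)

lemma abelian_group: "abelian_group V"
  using module by (rule module.axioms(2))

lemmas add_closed [simp, intro] = abelian_monoid.a_closed[OF abelian_group.axioms(1)[OF abelian_group]]
  and zero_closed [simp, intro] = abelian_monoid.zero_closed[OF abelian_group.axioms(1)[OF abelian_group]]
  and l_zero [simp] = abelian_monoid.l_zero[OF abelian_group.axioms(1)[OF abelian_group]]
  and r_zero [simp] = abelian_monoid.r_zero[OF abelian_group.axioms(1)[OF abelian_group]]
  and add_assoc = abelian_monoid.a_assoc[OF abelian_group.axioms(1)[OF abelian_group]]
  and add_comm = abelian_monoid.a_comm[OF abelian_group.axioms(1)[OF abelian_group]]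
  and minus_closed [simp, intro] = abelian_group.minus_closed[OF abelian_group]

lemma scale_closed [simp, intro]: "x \<in> carrier V \<Longrightarrow> a \<odot> x \<in> carrier V"
  using module.smult_closed[OF module, of a x] by simp

lemma scale_add_right: "x \<in> carrier V \<Longrightarrow> y \<in> carrier V \<Longrightarrow> a \<odot> (x \<oplus> y) = a \<odot> x \<oplus> a \<odot> y"
  using module.smult_r_distr[OF module, of a x y] by simp

lemma scale_add_left: "x \<in> carrier V \<Longrightarrow> (a + b) \<odot> x = a \<odot> x \<oplus> b \<odot> x"
  using module.smult_l_distr[OF module, of a b x] by simp

lemma scale_scale: "x \<in> carrier V \<Longrightarrow> a \<odot> (b \<odot> x) = (a * b) \<odot> x"
  using module.smult_assoc1[OF module, of a b x] by simp

lemma scale_1 [simp]: "x \<in> carrier V \<Longrightarrow> 1 \<odot> x = x"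
  using module.smult_one[OF module, of x] by simp

lemma scale_0 [simp]: "x \<in> carrier V \<Longrightarrow> 0 \<odot> x = \<zero>"
  using module.smult_l_null[OF module, of x] by simp

lemma scale_zero [simp]: "a \<odot> \<zero> = \<zero>"
  using module.smult_r_null[OF module, of a] by simp

lemma minus_eq: "x \<in> carrier V \<Longrightarrow> y \<in> carrier V \<Longrightarrow> x \<ominus> y = x \<oplus> (-1) \<odot> y"
proof -
  assume x: "x \<in> carrier V" and y: "y \<in> carrier V"
  have "y \<oplus> (-1) \<odot> y = \<zero>"
    using scale_add_left[of y 1 "-1"] y by simp
  then have "\<ominus> y = (-1) \<odot> y"
    using abelian_group.minus_equality[OF abelian_group, of "(-1) \<odot> y" y] y
    by (simp add: add_comm)
  then show ?thesis by (simp add: a_minus_def)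
qed

lemma minus_self [simp]: "x \<in> carrier V \<Longrightarrow> x \<ominus> x = \<zero>"
  using scale_add_left[of x 1 "-1"] by (simp add: minus_eq)

lemma add_left_comm: "x \<in> carrier V \<Longrightarrow> y \<in> carrier V \<Longrightarrow> z \<in> carrier V \<Longrightarrow> x \<oplus> (y \<oplus> z) = y \<oplus> (x \<oplus> z)"
  using add_assoc[of x y z] add_assoc[of y x z] add_comm[of x y] by simp

lemma add_neg [simp]: "x \<in> carrier V \<Longrightarrow> x \<oplus> (-1) \<odot> x = \<zero>"
  using minus_self[of x] minus_eq[of x x] by simp

lemma neg_add_cancel [simp]:
  "x \<in> carrier V \<Longrightarrow> y \<in> carrier V \<Longrightarrow> (-1) \<odot> x \<oplus> (x \<oplus> y) = y"
  using add_assoc[of "(-1) \<odot> x" x y] add_comm[of "(-1) \<odot> x" x] by simp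

lemma minus_add_cancel: "x \<in> carrier V \<Longrightarrow> y \<in> carrier V \<Longrightarrow> (x \<ominus> y) \<oplus> y = x"
  using add_comm[of "(-1) \<odot> y" y] by (simp add: minus_eq add_assoc)

lemma minus_trans:
  "x \<in> carrier V \<Longrightarrow> y \<in> carrier V \<Longrightarrow> z \<in> carrier V \<Longrightarrow> (z \<ominus> x) \<oplus> (x \<ominus> y) = z \<ominus> y"
  by (simp add: minus_eq add_assoc)

lemma neg_minus:
  "x \<in> carrier V \<Longrightarrow> y \<in> carrier V \<Longrightarrow> (-1) \<odot> (x \<ominus> y) = y \<ominus> x"
  by (simp add: minus_eq scale_add_right scale_scale add_comm)

end

lemma kspaceI:
  fixes V :: "('k::field, 'v, 'm) module_scheme" (structure)
  assumes "\<And>x y. x \<in> carrier V \<Longrightarrow> y \<in> carrier V \<Longrightarrow> x \<oplus> y \<in> carrier V"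
    and "\<zero> \<in> carrier V"
    and "\<And>a x. x \<in> carrier V \<Longrightarrow> a \<odot> x \<in> carrier V"
    and "\<And>x y z. x \<in> carrier V \<Longrightarrow> y \<in> carrier V \<Longrightarrow> z \<in> carrier V \<Longrightarrow> (x \<oplus> y) \<oplus> z = x \<oplus> (y \<oplus> z)"
    and "\<And>x y. x \<in> carrier V \<Longrightarrow> y \<in> carrier V \<Longrightarrow> x \<oplus> y = y \<oplus> x"
    and "\<And>x. x \<in> carrier V \<Longrightarrow> x \<oplus> \<zero> = x"
    and scale_0: "\<And>x. x \<in> carrier V \<Longrightarrow> 0 \<odot> x = \<zero>"
    and scale_1: "\<And>x. x \<in> carrier V \<Longrightarrow> 1 \<odot> x = x"
    and "\<And>a b x. x \<in> carrier V \<Longrightarrow> (a * b) \<odot> x = a \<odot> (b \<odot> x)"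
    and scale_add_left: "\<And>a b x. x \<in> carrier V \<Longrightarrow> (a + b) \<odot> x = a \<odot> x \<oplus> b \<odot> x"
    and "\<And>a x y. x \<in> carrier V \<Longrightarrow> y \<in> carrier V \<Longrightarrow> a \<odot> (x \<oplus> y) = a \<odot> x \<oplus> a \<odot> y"
  shows "kspace V"
proof (rule kspace.intro)
  \<comment> \<open>The scalar -1 supplies additive inverses.\<close>
  have neg: "\<exists>y\<in>carrier V. x \<oplus> y = \<zero>" if x: "x \<in> carrier V" for x
    using scale_add_left[of x 1 "-1"] scale_0 scale_1 x assms(3) by (intro bexI[of _ "(-1) \<odot> x"]) auto
  have "cring (class_ring :: 'k ring)"
    using class_field by (rule field.axioms(1)[THEN domain.axioms(1)])
  then have "module (class_ring :: 'k ring) V"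
    by (rule module_criteria) (use assms neg in auto)
  then show "vectorspace (class_ring :: 'k ring) V"
    using class_field by (simp add: vectorspace_def)
qed

section \<open>Linear maps and polynomial-valued linear functionals\<close>

abbreviation Hom :: "('k::field, 'v, 'm) module_scheme \<Rightarrow> ('k, 'w, 'n) module_scheme \<Rightarrow> ('v \<Rightarrow> 'w) set" where
  "Hom \<equiv> LinearCombinations.module_hom (class_ring :: 'k ring)"

lemma Hom_iff:
  "f \<in> Hom V W \<longleftrightarrow> (\<forall>x\<in>carrier V. f x \<in> carrier W) \<and>
     (\<forall>x\<in>carrier V. \<forall>y\<in>carrier V. f (x \<oplus>\<^bsub>V\<^esub> y) = f x \<oplus>\<^bsub>W\<^esub> f y) \<and>
     (\<forall>a. \<forall>x\<in>carrier V. f (a \<odot>\<^bsub>V\<^esub> x) = a \<odot>\<^bsub>W\<^esub> f x)"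
  unfolding LinearCombinations.module_hom_def by auto

lemma HomI:
  assumes "\<And>x. x \<in> carrier V \<Longrightarrow> f x \<in> carrier W"
    and "\<And>x y. x \<in> carrier V \<Longrightarrow> y \<in> carrier V \<Longrightarrow> f (x \<oplus>\<^bsub>V\<^esub> y) = f x \<oplus>\<^bsub>W\<^esub> f y"
    and "\<And>a x. x \<in> carrier V \<Longrightarrow> f (a \<odot>\<^bsub>V\<^esub> x) = a \<odot>\<^bsub>W\<^esub> f x"
  shows "f \<in> Hom V W"
  using assms by (simp add: Hom_iff)

lemma HomD:
  assumes "f \<in> Hom V W"
  shows "x \<in> carrier V \<Longrightarrow> f x \<in> carrier W"
    and "x \<in> carrier V \<Longrightarrow> y \<in> carrier V \<Longrightarrow> f (x \<oplus>\<^bsub>V\<^esub> y) = f x \<oplus>\<^bsub>W\<^esub> f y"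
    and "x \<in> carrier V \<Longrightarrow> f (a \<odot>\<^bsub>V\<^esub> x) = a \<odot>\<^bsub>W\<^esub> f x"
  using assms by (simp_all add: Hom_iff)

lemma Hom_comp: "f \<in> Hom X Y \<Longrightarrow> g \<in> Hom Y Z \<Longrightarrow> (\<lambda>x. g (f x)) \<in> Hom X Z"
  by (simp add: Hom_iff)

lemma Hom_id: "(\<lambda>x. x) \<in> Hom X X"
  by (simp add: Hom_iff)

lemma Hom_zero: "kspace V \<Longrightarrow> kspace W \<Longrightarrow> f \<in> Hom V W \<Longrightarrow> f \<zero>\<^bsub>V\<^esub> = \<zero>\<^bsub>W\<^esub>"
  by (metis HomD(1,3) kspace.scale_0 kspace.zero_closed)

lemma Hom_minus:
  assumes "kspace V" "kspace W" "f \<in> Hom V W" "x \<in> carrier V" "y \<in> carrier V"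
  shows "f (x \<ominus>\<^bsub>V\<^esub> y) = f x \<ominus>\<^bsub>W\<^esub> f y"
  using assms by (simp add: kspace.minus_eq HomD kspace.scale_closed)

text \<open>The target \<open>K[X]\<close> is a type with class operations rather than a module
  record, so that values can be multiplied and compared by degree.\<close>

definition linfun :: "('k::field, 'v, 'm) module_scheme \<Rightarrow> ('v \<Rightarrow> 'k poly) \<Rightarrow> bool" where
  "linfun V f \<longleftrightarrow> (\<forall>x\<in>carrier V. \<forall>y\<in>carrier V. f (x \<oplus>\<^bsub>V\<^esub> y) = f x + f y) \<and>
     (\<forall>a. \<forall>x\<in>carrier V. f (a \<odot>\<^bsub>V\<^esub> x) = Polynomial.smult a (f x))"

lemma linfunD:
  assumes "linfun V f"
  shows "x \<in> carrier V \<Longrightarrow> y \<in> carrier V \<Longrightarrow> f (x \<oplus>\<^bsub>V\<^esub> y) = f x + f y"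
    and "x \<in> carrier V \<Longrightarrow> f (a \<odot>\<^bsub>V\<^esub> x) = Polynomial.smult a (f x)"
  using assms by (simp_all add: linfun_def)

lemma linfun_const_zero: "linfun V (\<lambda>_. 0)"
  by (simp add: linfun_def)

lemma linfun_zero: "kspace V \<Longrightarrow> linfun V f \<Longrightarrow> f \<zero>\<^bsub>V\<^esub> = 0"
  by (metis linfunD(2) kspace.scale_0 kspace.zero_closed smult_0_left)

lemma linfun_minus:
  "kspace V \<Longrightarrow> linfun V f \<Longrightarrow> x \<in> carrier V \<Longrightarrow> y \<in> carrier V \<Longrightarrow> f (x \<ominus>\<^bsub>V\<^esub> y) = f x - f y"
  by (simp add: kspace.minus_eq linfunD kspace.scale_closed)

lemma linfun_Hom: "linfun W f \<Longrightarrow> g \<in> Hom V W \<Longrightarrow> linfun V (\<lambda>x. f (g x))"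
  by (simp add: linfun_def Hom_iff)


text \<open>An inductive form of the span, so that linear statements are proved by rule induction;
  \<open>span_eq_lspan\<close> ties it to the span used in the definitions.\<close>

inductive_set lspan :: "('k::field, 'v, 'm) module_scheme \<Rightarrow> 'v set \<Rightarrow> 'v set"
  for V (structure) and S
  where
    zero: "\<zero> \<in> lspan V S"
  | base: "x \<in> S \<Longrightarrow> x \<in> lspan V S"
  | add: "x \<in> lspan V S \<Longrightarrow> y \<in> lspan V S \<Longrightarrow> x \<oplus> y \<in> lspan V S"
  | smult: "x \<in> lspan V S \<Longrightarrow> a \<odot> x \<in> lspan V S"

lemma (in kspace) lspan_subset: "S \<subseteq> carrier V \<Longrightarrow> lspan V S \<subseteq> carrier V"
proof
  fix x assume S: "S \<subseteq> carrier V" and "x \<in> lspan V S"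
  from this(2) show "x \<in> carrier V" by induction (use S in auto)
qed

lemma lspan_trans: "x \<in> lspan V S \<Longrightarrow> S \<subseteq> lspan V T \<Longrightarrow> x \<in> lspan V T"
  by (induction rule: lspan.induct) (auto intro: lspan.intros)

lemma (in kspace) submodule_iff:
  "submodule (class_ring :: 'k ring) N V \<longleftrightarrow> N \<subseteq> carrier V \<and> \<zero> \<in> N \<and>
     (\<forall>x\<in>N. \<forall>y\<in>N. x \<oplus> y \<in> N) \<and> (\<forall>a. \<forall>x\<in>N. a \<odot> x \<in> N)"
  using module by (auto simp: submodule_def)

lemma (in kspace) span_eq_lspan:
  assumes S: "S \<subseteq> carrier V"
  shows "LinearCombinations.module.span (class_ring :: 'k ring) V S = lspan V S"
proof
  have "submodule (class_ring :: 'k ring) (lspan V S) V"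
    using lspan_subset[OF S] by (auto simp: submodule_iff intro: lspan.intros)
  then show "LinearCombinations.module.span (class_ring :: 'k ring) V S \<subseteq> lspan V S"
    by (rule module.span_is_subset[OF module, rotated]) (auto intro: lspan.base)
  have sub: "submodule (class_ring :: 'k ring) (LinearCombinations.module.span (class_ring :: 'k ring) V S) V"
    by (rule module.span_is_submodule[OF module S])
  show "lspan V S \<subseteq> LinearCombinations.module.span (class_ring :: 'k ring) V S"
  proof
    fix x assume "x \<in> lspan V S"
    then show "x \<in> LinearCombinations.module.span (class_ring :: 'k ring) V S"
      by induction (use sub module.in_own_span[OF module S] in \<open>auto simp: submodule_iff\<close>)
  qed
qed

lemma (in kspace) subspace_kspace:
  assumes "N \<subseteq> carrier V" "\<zero> \<in> N" "\<And>x y. x \<in> N \<Longrightarrow> y \<in> N \<Longrightarrow> x \<oplus> y \<in> N"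
    "\<And>a x. x \<in> N \<Longrightarrow> a \<odot> x \<in> N"
  shows "kspace (V\<lparr>carrier := N\<rparr>)"
proof -
  have "submodule (class_ring :: 'k ring) N V"
    using assms by (auto simp: submodule_iff)
  then have "module (class_ring :: 'k ring) (V\<lparr>carrier := N\<rparr>)"
    by (rule module.submodule_is_module[OF module])
  then show ?thesis
    using class_field by (simp add: kspace_def vectorspace_def)
qed

section \<open>Quotients by subspaces\<close>

locale kquot = kspace M for M :: "('k::field, 'v, 'm) module_scheme" (structure) +
  fixes N
  assumes N_sub: "N \<subseteq> carrier M" and N_zero: "\<zero> \<in> N"
    and N_add: "x \<in> N \<Longrightarrow> y \<in> N \<Longrightarrow> x \<oplus> y \<in> N"
    and N_smult: "x \<in> N \<Longrightarrow> a \<odot> x \<in> N"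
begin

abbreviation "Q \<equiv> quot_module M N"

lemma N_carrier [simp]: "x \<in> N \<Longrightarrow> x \<in> carrier M"
  using N_sub by auto

lemma mem_coset_iff: "x \<in> carrier M \<Longrightarrow> y \<in> N +> x \<longleftrightarrow> y \<in> carrier M \<and> y \<ominus> x \<in> N"
proof
  assume x: "x \<in> carrier M" and "y \<in> N +> x"
  then obtain n where n: "n \<in> N" "y = n \<oplus> x" by (auto simp: a_r_coset_def')
  have "n \<oplus> x \<ominus> x = n"
    using n x scale_add_left[of x 1 "-1"] by (simp add: minus_eq add_assoc)
  then show "y \<in> carrier M \<and> y \<ominus> x \<in> N" using n x by simp
next
  assume x: "x \<in> carrier M" and y: "y \<in> carrier M \<and> y \<ominus> x \<in> N"
  then have "y = (y \<ominus> x) \<oplus> x" by (simp add: minus_add_cancel)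
  then show "y \<in> N +> x" using y by (auto simp: a_r_coset_def')
qed

lemma self_mem_coset: "x \<in> carrier M \<Longrightarrow> x \<in> N +> x"
  by (simp add: mem_coset_iff N_zero)

lemma coset_eq_iff: 
  assumes x: "x \<in> carrier M" and y: "y \<in> carrier M"
  shows "N +> x = N +> y \<longleftrightarrow> x \<ominus> y \<in> N"
proof
  assume "N +> x = N +> y"
  then show "x \<ominus> y \<in> N" using self_mem_coset[OF x] by (simp add: mem_coset_iff y)
next
  assume N: "x \<ominus> y \<in> N"
  have "z \<ominus> y \<in> N \<longleftrightarrow> z \<ominus> x \<in> N" if z: "z \<in> carrier M" for z
    using N_add[OF _ N, of "z \<ominus> x"] N_add[OF _ N_smult[OF N, of "-1"], of "z \<ominus> y"] x y z
    by (auto simp: minus_trans neg_minus)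
  then show "N +> x = N +> y"
    by (auto simp: mem_coset_iff x y)
qed

lemma coset_zero: "N +> \<zero> = N"
  by (auto simp: mem_coset_iff minus_eq)

lemma quot_carrier: "carrier Q = (\<lambda>x. N +> x) ` carrier M"
  by (auto simp: quot_module_def A_RCOSETS_def')

lemma quot_zero: "\<zero>\<^bsub>Q\<^esub> = N +> \<zero>"
  by (simp add: quot_module_def coset_zero)

lemma quot_add:
  assumes "x \<in> carrier M" "y \<in> carrier M"
  shows "(N +> x) \<oplus>\<^bsub>Q\<^esub> (N +> y) = N +> (x \<oplus> y)"
proof -
  have *: "(n \<oplus> x) \<oplus> (n' \<oplus> y) = (n \<oplus> n') \<oplus> (x \<oplus> y)" if "n \<in> N" "n' \<in> N" for n n'
    using that assms by (simp add: add_assoc add_left_comm[of x n' y])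
  have "z \<in> N +> x <+> (N +> y) \<longleftrightarrow> z \<in> N +> (x \<oplus> y)" for z
  proof
    assume "z \<in> N +> x <+> (N +> y)"
    then obtain n n' where "n \<in> N" "n' \<in> N" "z = (n \<oplus> x) \<oplus> (n' \<oplus> y)"
      by (auto simp: set_add_def' a_r_coset_def')
    then show "z \<in> N +> (x \<oplus> y)" by (auto simp: a_r_coset_def' * intro: N_add)
  next
    assume "z \<in> N +> (x \<oplus> y)"
    then obtain n where n: "n \<in> N" "z = n \<oplus> (x \<oplus> y)" by (auto simp: a_r_coset_def')
    have "z = (n \<oplus> x) \<oplus> (\<zero> \<oplus> y)" using *[of n \<zero>] n N_zero by simp
    then show "z \<in> N +> x <+> (N +> y)"
      using n N_zero unfolding set_add_def' a_r_coset_def' by blast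
  qed
  then show ?thesis by (auto simp: quot_module_def)
qed

text \<open>\<open>quot_map\<close> and the scalar action of the quotient are unions over all
  representatives of a coset. The difference of two images is the image of a difference, hence in N;
  so every representative contributes the same coset and the union collapses to it.\<close>

lemma coset_map_cong:
  assumes f: "f \<in> Hom M M" and fN: "\<And>n. n \<in> N \<Longrightarrow> f n \<in> N" and x: "x \<in> carrier M" and y: "y \<in> N +> x"
  shows "N +> f y = N +> f x"
proof -
  have y': "y \<in> carrier M" "y \<ominus> x \<in> N" using y x by (auto simp: mem_coset_iff)
  have "f y \<ominus> f x = f (y \<ominus> x)"
    using Hom_minus[OF kspace_axioms kspace_axioms f] x y' by simp
  then show ?thesis using fN y' x by (simp add: coset_eq_iff HomD(1)[OF f])
qed

lemma scale_Hom: "(\<lambda>x. a \<odot> x) \<in> Hom M M"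
  by (rule HomI) (auto simp: scale_add_right scale_scale mult.commute)

lemma quot_smult: "x \<in> carrier M \<Longrightarrow> a \<odot>\<^bsub>Q\<^esub> (N +> x) = N +> (a \<odot> x)"
proof -
  assume x: "x \<in> carrier M"
  have "a \<odot>\<^bsub>Q\<^esub> (N +> x) = (\<Union>y\<in>N +> x. N +> (a \<odot> y))"
    by (simp add: quot_module_def)
  also have "\<dots> = N +> (a \<odot> x)"
    by (rule UN_constant_eq[OF self_mem_coset[OF x]]) (intro ballI coset_map_cong[OF scale_Hom N_smult x])
  finally show ?thesis .
qed

lemma quot_kspace: "kspace Q"
proof (rule kspaceI)
  fix X Y assume "X \<in> carrier Q" "Y \<in> carrier Q"
  then show "X \<oplus>\<^bsub>Q\<^esub> Y = Y \<oplus>\<^bsub>Q\<^esub> X"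
    using add_comm by (auto simp: quot_carrier quot_add)
qed (auto simp: quot_carrier quot_zero quot_add quot_smult scale_add_right scale_add_left scale_scale
      add_assoc)

lemma coset_Hom: "(\<lambda>x. N +> x) \<in> Hom M Q"
  by (rule HomI) (auto simp: quot_carrier quot_add quot_smult)

lemma quot_map_coset:
  assumes "f \<in> Hom M M" "\<And>n. n \<in> N \<Longrightarrow> f n \<in> N" "x \<in> carrier M"
  shows "quot_map M N f (N +> x) = N +> f x"
proof -
  have "quot_map M N f (N +> x) = (\<Union>y\<in>N +> x. N +> f y)"
    using assms(3) by (simp add: quot_map_def quot_carrier)
  also have "\<dots> = N +> f x"
    by (rule UN_constant_eq[OF self_mem_coset[OF assms(3)]]) (intro ballI coset_map_cong[OF assms])
  finally show ?thesis .
qed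

lemma quot_map_Hom:
  assumes "f \<in> Hom M M" "\<And>n. n \<in> N \<Longrightarrow> f n \<in> N"
  shows "quot_map M N f \<in> Hom Q Q"
  by (rule HomI)
    (auto simp: quot_carrier quot_add quot_smult quot_map_coset[OF assms] HomD[OF assms(1)])

lemma quot_map_extensional: "quot_map M N f \<in> extensional (carrier Q)"
  by (simp add: quot_map_def)

lemma linfun_coset_cong:
  assumes "linfun M f" "\<And>n. n \<in> N \<Longrightarrow> f n = 0" "x \<in> carrier M" "y \<in> N +> x"
  shows "f y = f x"
  using assms linfun_minus[OF kspace_axioms assms(1), of y x] by (auto simp: mem_coset_iff)

text \<open>A coset is evaluated at a chosen representative. As f vanishes on N, the choice does not
  affect the value, and linearity is inherited.\<close>

lemma linfun_quot:
  assumes f: "linfun M f" "\<And>n. n \<in> N \<Longrightarrow> f n = 0"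
  shows "x \<in> carrier M \<Longrightarrow> f (SOME y. y \<in> N +> x) = f x"
    and "linfun Q (\<lambda>X. f (SOME y. y \<in> X))"
proof -
  show *: "f (SOME y. y \<in> N +> x) = f x" if "x \<in> carrier M" for x
    by (rule linfun_coset_cong[OF f that]) (auto intro: someI[where P = "\<lambda>y. y \<in> N +> x"] self_mem_coset that)
  show "linfun Q (\<lambda>X. f (SOME y. y \<in> X))"
    unfolding linfun_def by (auto simp: quot_carrier quot_add quot_smult * linfunD[OF f(1)])
qed

lemma quot_lspan:
  assumes "carrier M \<subseteq> lspan M S" "S \<subseteq> carrier M"
  shows "carrier Q \<subseteq> lspan Q ((\<lambda>x. N +> x) ` S)"
proof
  fix X assume "X \<in> carrier Q"
  then obtain x where x: "x \<in> lspan M S" "X = N +> x" using assms by (auto simp: quot_carrier)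
  from x(1) have "N +> x \<in> lspan Q ((\<lambda>x. N +> x) ` S)"
  proof induction
    case zero show ?case using lspan.zero[of Q] by (simp add: quot_zero)
  next
    case (base x) then show ?case by (auto intro: lspan.base)
  next
    case (add x y) then show ?case
      using lspan_subset[OF assms(2)] using lspan.add[OF add.IH] by (simp add: quot_add subset_iff)
  next
    case (smult x a) then show ?case
      using lspan_subset[OF assms(2)] using lspan.smult[OF smult.IH, of a] by (simp add: quot_smult subset_iff)
  qed
  then show "X \<in> lspan Q ((\<lambda>x. N +> x) ` S)" using x by simp
qed

end

lemma (in kspace) kquot_lspan: "S \<subseteq> carrier V \<Longrightarrow> kquot V (lspan V S)"
  by unfold_locales (use lspan_subset in \<open>auto intro: lspan.intros\<close>)

section \<open>Tensor powers\<close>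

lemma Hom_eq_on_lspan:
  assumes W: "kspace V" "kspace W" and f: "f \<in> Hom V W" and g: "g \<in> Hom V W"
    and S: "S \<subseteq> carrier V" and eq: "\<And>x. x \<in> S \<Longrightarrow> f x = g x" and x: "x \<in> lspan V S"
  shows "f x = g x"
proof -
  have sub: "lspan V S \<subseteq> carrier V" by (rule kspace.lspan_subset[OF W(1) S])
  from x show ?thesis
    by induction (use sub eq in \<open>auto simp: Hom_zero[OF W f] Hom_zero[OF W g] HomD[OF f] HomD[OF g] subset_iff\<close>)
qed

lemma linfun_eq_on_lspan:
  assumes V: "kspace V" and f: "linfun V f" and g: "linfun V g"
    and S: "S \<subseteq> carrier V" and eq: "\<And>x. x \<in> S \<Longrightarrow> f x = g x" and x: "x \<in> lspan V S"
  shows "f x = g x"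
proof -
  have sub: "lspan V S \<subseteq> carrier V" by (rule kspace.lspan_subset[OF V S])
  from x show ?thesis
    by induction (use sub eq in \<open>auto simp: linfun_zero[OF V f] linfun_zero[OF V g] linfunD[OF f] linfunD[OF g] subset_iff\<close>)
qed

lemma tuples_iff: "xs \<in> tuples V r \<longleftrightarrow> length xs = r \<and> (\<forall>i<r. xs ! i \<in> carrier V)"
  by (auto simp: tuples_def in_set_conv_nth subset_iff)

lemma tuples_update: "xs \<in> tuples V r \<Longrightarrow> x \<in> carrier V \<Longrightarrow> xs[i := x] \<in> tuples V r"
  using set_update_subset_insert[of xs i x] by (auto simp: tuples_def)

lemma tuples_map: "xs \<in> tuples V r \<Longrightarrow> (\<And>x. x \<in> carrier V \<Longrightarrow> g x \<in> carrier W) \<Longrightarrow> map g xs \<in> tuples W r"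
  by (simp add: tuples_iff)


section \<open>Linear extension from tuples to the free module\<close>

definition lin_ext :: "('a \<Rightarrow> 'k poly) \<Rightarrow> ('a \<Rightarrow> 'k::field) \<Rightarrow> 'k poly" where
  "lin_ext \<phi> f = (\<Sum>xs | f xs \<noteq> 0. Polynomial.smult (f xs) (\<phi> xs))"

text \<open>Functions with different supports become comparable once their sums run over one common
  finite set; additivity is obtained in this way.\<close>

lemma lin_ext_superset:
  "finite S \<Longrightarrow> {xs. f xs \<noteq> 0} \<subseteq> S \<Longrightarrow> lin_ext \<phi> f = (\<Sum>xs\<in>S. Polynomial.smult (f xs) (\<phi> xs))"
  unfolding lin_ext_def by (rule sum.mono_neutral_left) auto

lemma lin_ext_add:
  assumes "finite {xs. f xs \<noteq> 0}" "finite {xs. g xs \<noteq> 0}"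
  shows "lin_ext \<phi> (\<lambda>xs. f xs + g xs) = lin_ext \<phi> f + lin_ext \<phi> g"
proof -
  let ?S = "{xs. f xs \<noteq> 0} \<union> {xs. g xs \<noteq> 0}"
  have "lin_ext \<phi> h = (\<Sum>xs\<in>?S. Polynomial.smult (h xs) (\<phi> xs))"
    if "h = f \<or> h = g \<or> h = (\<lambda>xs. f xs + g xs)" for h
    using assms that by (intro lin_ext_superset) auto
  then show ?thesis by (simp add: smult_add_left sum.distrib)
qed

lemma lin_ext_smult:
  assumes "finite {xs. f xs \<noteq> 0}"
  shows "lin_ext \<phi> (\<lambda>xs. a * f xs) = Polynomial.smult a (lin_ext \<phi> f)"
proof -
  have "lin_ext \<phi> (\<lambda>xs. a * f xs) = (\<Sum>xs | f xs \<noteq> 0. Polynomial.smult (a * f xs) (\<phi> xs))"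
    by (rule lin_ext_superset[OF assms]) auto
  then show ?thesis
    using sum_distrib_left[of "[:a:]" "\<lambda>xs. Polynomial.smult (f xs) (\<phi> xs)"]
    by (simp add: lin_ext_def mult.commute)
qed


locale tensor = kspace V for V :: "('k::field, 'v, 'm) module_scheme" +
  fixes r :: nat
begin

abbreviation "F \<equiv> free_tuples (class_ring :: 'k ring) V r"
abbreviation "N \<equiv> tensor_kernel (class_ring :: 'k ring) V r"
abbreviation "T \<equiv> tensor_power (class_ring :: 'k ring) r V"
abbreviation "b \<equiv> tuple_basis (class_ring :: 'k ring) :: 'v list \<Rightarrow> _"

lemma F_simps [simp]:
  "f \<in> carrier F \<longleftrightarrow> finite {xs. f xs \<noteq> 0} \<and> {xs. f xs \<noteq> 0} \<subseteq> tuples V r"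
  "f \<oplus>\<^bsub>F\<^esub> g = (\<lambda>xs. f xs + g xs)"
  "a \<odot>\<^bsub>F\<^esub> f = (\<lambda>xs. a * f xs)"
  "\<zero>\<^bsub>F\<^esub> = (\<lambda>xs. 0)"
  by (simp_all add: free_tuples_def)

lemma b_apply: "b xs ys = (if ys = xs then 1 else 0)"
  by (simp add: tuple_basis_def)

lemma b_carrier: "xs \<in> tuples V r \<Longrightarrow> b xs \<in> carrier F"
  by (simp add: b_apply)

lemma F_kspace: "kspace F"
proof (rule kspaceI)
  fix f g assume "f \<in> carrier F" "g \<in> carrier F"
  then show "f \<oplus>\<^bsub>F\<^esub> g \<in> carrier F"
    by (auto intro: finite_subset[of _ "{xs. f xs \<noteq> 0} \<union> {xs. g xs \<noteq> 0}"] simp: subset_iff)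
      (metis add.right_neutral)
next
  fix a f assume "f \<in> carrier F"
  then show "a \<odot>\<^bsub>F\<^esub> f \<in> carrier F"
    by (auto intro: finite_subset[of _ "{xs. f xs \<noteq> 0}"])
qed (auto simp: algebra_simps)

sublocale F: kspace F by (rule F_kspace)

lemma F_lspan: "carrier F \<subseteq> lspan F (b ` tuples V r)"
proof
  fix f assume f: "f \<in> carrier F"
  have *: "f \<in> lspan F (b ` tuples V r)"
    if "finite S" "S \<subseteq> tuples V r" "{xs. f xs \<noteq> 0} \<subseteq> S" for S f
    using that
  proof (induction S arbitrary: f rule: finite_induct)
    case empty
    then have "f = \<zero>\<^bsub>F\<^esub>" by auto
    then show ?case by (metis lspan.zero)
  next
    case (insert ys S)
    have "f(ys := 0) \<in> lspan F (b ` tuples V r)"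
      using insert.prems by (intro insert.IH) auto
    moreover have "f ys \<odot>\<^bsub>F\<^esub> b ys \<in> lspan F (b ` tuples V r)"
      using insert.prems by (intro lspan.smult lspan.base) auto
    moreover have "f = f(ys := 0) \<oplus>\<^bsub>F\<^esub> f ys \<odot>\<^bsub>F\<^esub> b ys"
      by (auto simp: b_apply)
    ultimately show ?case by (metis lspan.add)
  qed
  show "f \<in> lspan F (b ` tuples V r)" using *[of "{xs. f xs \<noteq> 0}" f] f by simp
qed

lemma linfun_lin_ext: "linfun F (lin_ext \<phi>)"
  unfolding linfun_def by (auto simp: lin_ext_add lin_ext_smult)

lemma lin_ext_b: "lin_ext \<phi> (b xs) = \<phi> xs"
  by (simp add: lin_ext_superset[of "{xs}"] b_apply)

text \<open>The linear extension in the body of \<open>tensor_map\<close>, named so that it can be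
  shown to preserve the multilinear relations.\<close>

definition "lin_map \<phi> f = (\<Oplus>\<^bsub>F\<^esub>xs\<in>{xs. f xs \<noteq> 0}. f xs \<odot>\<^bsub>F\<^esub> b (\<phi> xs))"

lemma finsum_F:
  assumes "finite A" "\<And>x. x \<in> A \<Longrightarrow> h x \<in> carrier F"
  shows "finsum F h A = (\<lambda>ys. \<Sum>x\<in>A. h x ys)"
proof -
  interpret FM: abelian_group F by (rule F.abelian_group)
  from assms show ?thesis
  proof (induction A rule: finite_induct)
    case empty show ?case by (simp only: FM.finsum_empty) simp
  next
    case (insert x A)
    have "finsum F h (insert x A) = h x \<oplus>\<^bsub>F\<^esub> finsum F h A"
      by (rule FM.finsum_insert) (use insert in auto)
    then show ?case using insert by simp
  qed
qed

lemma lin_map_eq: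
  assumes "\<And>xs. xs \<in> tuples V r \<Longrightarrow> \<phi> xs \<in> tuples V r" "f \<in> carrier F"
    "finite S" "{xs. f xs \<noteq> 0} \<subseteq> S"
  shows "lin_map \<phi> f = (\<lambda>ys. \<Sum>xs\<in>S. f xs * b (\<phi> xs) ys)"
proof -
  have "lin_map \<phi> f = (\<lambda>ys. \<Sum>xs | f xs \<noteq> 0. (f xs \<odot>\<^bsub>F\<^esub> b (\<phi> xs)) ys)"
    unfolding lin_map_def using assms by (intro finsum_F F.scale_closed b_carrier) auto
  also have "\<dots> = (\<lambda>ys. \<Sum>xs\<in>S. f xs * b (\<phi> xs) ys)"
    using assms by (auto intro!: sum.mono_neutral_cong_left)
  finally show ?thesis .
qed

lemma lin_map_Hom:
  assumes \<phi>: "\<And>xs. xs \<in> tuples V r \<Longrightarrow> \<phi> xs \<in> tuples V r"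
  shows "lin_map \<phi> \<in> Hom F F"
proof (rule HomI)
  interpret FM: abelian_group F by (rule F.abelian_group)
  show "lin_map \<phi> f \<in> carrier F" if "f \<in> carrier F" for f
    unfolding lin_map_def using that by (intro FM.finsum_closed Pi_I F.scale_closed b_carrier \<phi>) auto
next
  fix f g assume f: "f \<in> carrier F" and g: "g \<in> carrier F"
  let ?S = "{xs. f xs \<noteq> 0} \<union> {xs. g xs \<noteq> 0}"
  have "lin_map \<phi> h = (\<lambda>ys. \<Sum>xs\<in>?S. h xs * b (\<phi> xs) ys)"
    if "h = f \<or> h = g \<or> h = f \<oplus>\<^bsub>F\<^esub> g" for h
    by (rule lin_map_eq[OF \<phi>]) (use f g that F.add_closed[OF f g] in auto)
  then show "lin_map \<phi> (f \<oplus>\<^bsub>F\<^esub> g) = lin_map \<phi> f \<oplus>\<^bsub>F\<^esub> lin_map \<phi> g"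
    by (simp add: sum.distrib algebra_simps)
next
  fix a f assume f: "f \<in> carrier F"
  have "lin_map \<phi> h = (\<lambda>ys. \<Sum>xs | f xs \<noteq> 0. h xs * b (\<phi> xs) ys)"
    if "h = f \<or> h = a \<odot>\<^bsub>F\<^esub> f" for h
    by (rule lin_map_eq[OF \<phi>]) (use f that F.scale_closed[OF f, of a] in auto)
  then show "lin_map \<phi> (a \<odot>\<^bsub>F\<^esub> f) = a \<odot>\<^bsub>F\<^esub> lin_map \<phi> f"
    by (simp add: sum_distrib_left mult.assoc)
qed

lemma lin_map_b:
  assumes \<phi>: "\<And>xs. xs \<in> tuples V r \<Longrightarrow> \<phi> xs \<in> tuples V r" and "xs \<in> tuples V r"
  shows "lin_map \<phi> (b xs) = b (\<phi> xs)"
  using lin_map_eq[where f = "b xs" and S = "{xs}", OF \<phi>] b_carrier[OF assms(2)] by (auto simp: b_apply)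

definition "R = multilin_rels (class_ring :: 'k ring) V r"

lemma R_cases:
  assumes "z \<in> R"
  obtains (add) xs i x y where "xs \<in> tuples V r" "i < r" "x \<in> carrier V" "y \<in> carrier V"
    "z = b (xs[i := x \<oplus>\<^bsub>V\<^esub> y]) \<ominus>\<^bsub>F\<^esub> (b (xs[i := x]) \<oplus>\<^bsub>F\<^esub> b (xs[i := y]))"
  | (smult) xs i a x where "xs \<in> tuples V r" "i < r" "x \<in> carrier V"
    "z = b (xs[i := a \<odot>\<^bsub>V\<^esub> x]) \<ominus>\<^bsub>F\<^esub> a \<odot>\<^bsub>F\<^esub> b (xs[i := x])"
  using assms unfolding R_def multilin_rels_def Let_def by blast

lemma R_add:
  assumes "xs \<in> tuples V r" "i < r" "x \<in> carrier V" "y \<in> carrier V"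
  shows "b (xs[i := x \<oplus>\<^bsub>V\<^esub> y]) \<ominus>\<^bsub>F\<^esub> (b (xs[i := x]) \<oplus>\<^bsub>F\<^esub> b (xs[i := y])) \<in> R"
  using assms unfolding R_def multilin_rels_def Let_def by blast

lemma R_smult:
  assumes "xs \<in> tuples V r" "i < r" "x \<in> carrier V"
  shows "b (xs[i := a \<odot>\<^bsub>V\<^esub> x]) \<ominus>\<^bsub>F\<^esub> a \<odot>\<^bsub>F\<^esub> b (xs[i := x]) \<in> R"
  using assms unfolding R_def multilin_rels_def Let_def by fastforce

lemma R_carrier: "R \<subseteq> carrier F"
proof
  fix z assume "z \<in> R"
  then show "z \<in> carrier F"
    by (cases rule: R_cases)
      (simp_all only: F.minus_closed F.add_closed F.scale_closed b_carrier tuples_update add_closed scale_closed)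
qed

lemma N_eq: "N = lspan F R"
  unfolding tensor_kernel_def R_def[symmetric] by (rule F.span_eq_lspan[OF R_carrier])

sublocale TQ: kquot F N
  rewrites "quot_module F N = T"
  by (unfold N_eq) (use F.kquot_lspan[OF R_carrier] in \<open>simp_all add: tensor_power_def N_eq\<close>)

lemma T_kspace: "kspace T"
  by (rule TQ.quot_kspace)

end

definition pure_tensor :: "('k::field, 'v, 'm) module_scheme \<Rightarrow> 'v list \<Rightarrow> ('v list \<Rightarrow> 'k) set" where
  "pure_tensor V xs = tensor_kernel (class_ring :: 'k ring) V (length xs)
     +>\<^bsub>free_tuples (class_ring :: 'k ring) V (length xs)\<^esub> tuple_basis (class_ring :: 'k ring) xs"

text \<open>The form may differ from slot to slot, because the i-th factor will be evaluated at the
  i-th point.\<close>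

definition tensor_eval :: "(nat \<Rightarrow> 'v \<Rightarrow> 'k::field poly) \<Rightarrow> ('v list \<Rightarrow> 'k) set \<Rightarrow> 'k poly" where
  "tensor_eval \<Lambda> X = lin_ext (\<lambda>xs. \<Prod>i<length xs. \<Lambda> i (xs ! i)) (SOME f. f \<in> X)"

text \<open>A sufficient condition, covering both \<open>map g\<close> and place permutations, for \<open>tensor_map\<close> to preserve
  the multilinear relations.\<close>

definition slotwise_linear :: "('k::field, 'v, 'm) module_scheme \<Rightarrow> nat \<Rightarrow> ('v list \<Rightarrow> 'v list) \<Rightarrow> bool" where
  "slotwise_linear V r \<phi> \<longleftrightarrow> (\<forall>xs\<in>tuples V r. \<phi> xs \<in> tuples V r) \<and>
     (\<forall>xs\<in>tuples V r. \<forall>i<r. \<exists>ys\<in>tuples V r. \<exists>j<r. \<exists>g\<in>Hom V V.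
        \<forall>x\<in>carrier V. \<phi> (xs[i := x]) = ys[j := g x])"

context tensor
begin

lemma pure_tensor_eq: "xs \<in> tuples V r \<Longrightarrow> pure_tensor V xs = N +>\<^bsub>F\<^esub> b xs"
  by (auto simp: pure_tensor_def tuples_def)

lemma pure_tensor_closed: "xs \<in> tuples V r \<Longrightarrow> pure_tensor V xs \<in> carrier T"
  using b_carrier TQ.coset_Hom by (auto simp: pure_tensor_eq Hom_iff simp del: F_simps)

lemma pure_tensor_add:
  assumes "xs \<in> tuples V r" "i < r" "x \<in> carrier V" "y \<in> carrier V"
  shows "pure_tensor V (xs[i := x \<oplus>\<^bsub>V\<^esub> y]) = pure_tensor V (xs[i := x]) \<oplus>\<^bsub>T\<^esub> pure_tensor V (xs[i := y])"
proof -
  have *: "b (xs[i := x]) \<in> carrier F" "b (xs[i := y]) \<in> carrier F" "b (xs[i := x \<oplus>\<^bsub>V\<^esub> y]) \<in> carrier F"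
    using assms by (auto intro!: b_carrier tuples_update simp del: F_simps)
  have "b (xs[i := x \<oplus>\<^bsub>V\<^esub> y]) \<ominus>\<^bsub>F\<^esub> (b (xs[i := x]) \<oplus>\<^bsub>F\<^esub> b (xs[i := y])) \<in> N"
    unfolding N_eq using assms by (intro lspan.base R_add)
  then have "N +>\<^bsub>F\<^esub> b (xs[i := x \<oplus>\<^bsub>V\<^esub> y]) = N +>\<^bsub>F\<^esub> (b (xs[i := x]) \<oplus>\<^bsub>F\<^esub> b (xs[i := y]))"
    by (subst TQ.coset_eq_iff[OF *(3) F.add_closed[OF *(1,2)]])
  then show ?thesis
    using assms by (simp add: pure_tensor_eq tuples_update TQ.quot_add[OF *(1,2)] del: F_simps)
qed

lemma pure_tensor_smult:
  assumes "xs \<in> tuples V r" "i < r" "x \<in> carrier V"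
  shows "pure_tensor V (xs[i := a \<odot>\<^bsub>V\<^esub> x]) = a \<odot>\<^bsub>T\<^esub> pure_tensor V (xs[i := x])"
proof -
  have *: "b (xs[i := x]) \<in> carrier F" "b (xs[i := a \<odot>\<^bsub>V\<^esub> x]) \<in> carrier F"
    using assms by (auto intro!: b_carrier tuples_update simp del: F_simps)
  have "b (xs[i := a \<odot>\<^bsub>V\<^esub> x]) \<ominus>\<^bsub>F\<^esub> (a \<odot>\<^bsub>F\<^esub> b (xs[i := x])) \<in> N"
    unfolding N_eq using assms by (intro lspan.base R_smult)
  then have "N +>\<^bsub>F\<^esub> b (xs[i := a \<odot>\<^bsub>V\<^esub> x]) = N +>\<^bsub>F\<^esub> (a \<odot>\<^bsub>F\<^esub> b (xs[i := x]))"
    by (subst TQ.coset_eq_iff[OF *(2) F.scale_closed[OF *(1)]])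
  then show ?thesis
    using assms by (simp add: pure_tensor_eq tuples_update TQ.quot_smult[OF *(1)] del: F_simps)
qed

lemma T_lspan: "carrier T \<subseteq> lspan T (pure_tensor V ` tuples V r)"
proof -
  have "carrier T \<subseteq> lspan T ((\<lambda>f. N +>\<^bsub>F\<^esub> f) ` b ` tuples V r)"
    by (rule TQ.quot_lspan[OF F_lspan]) (use b_carrier in \<open>auto simp del: F_simps\<close>)
  also have "(\<lambda>f. N +>\<^bsub>F\<^esub> f) ` b ` tuples V r = pure_tensor V ` tuples V r"
    by (auto simp: pure_tensor_eq image_image intro!: image_cong)
  finally show ?thesis .
qed

text \<open>Varying x in slot i of \<open>xs\<close> varies only slot j of the image, through the
  linear map g. A generating relation is therefore sent to a generating relation, and the extension
  of \<phi> descends to the quotient.\<close>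

lemma
  assumes "slotwise_linear V r \<phi>"
  shows tensor_map_Hom: "tensor_map (class_ring :: 'k ring) r V \<phi> \<in> Hom T T"
    and tensor_map_pure: "xs \<in> tuples V r \<Longrightarrow> tensor_map (class_ring :: 'k ring) r V \<phi> (pure_tensor V xs) = pure_tensor V (\<phi> xs)"
proof -
  have \<phi>: "\<phi> xs \<in> tuples V r" if "xs \<in> tuples V r" for xs
    using assms that by (auto simp: slotwise_linear_def)
  note lm = lin_map_Hom[OF \<phi>]
  have tm: "tensor_map (class_ring :: 'k ring) r V \<phi> = quot_map F N (lin_map \<phi>)"
    by (simp only: tensor_map_def Let_def lin_map_def[abs_def]) simp
  have lmR: "lin_map \<phi> z \<in> R" if "z \<in> R" for z
    using that
  proof (cases rule: R_cases)
    case (add xs i x y)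
    obtain ys j g where *: "ys \<in> tuples V r" "j < r" "g \<in> Hom V V"
      "\<And>x. x \<in> carrier V \<Longrightarrow> \<phi> (xs[i := x]) = ys[j := g x]"
      using bspec[OF conjunct2[OF assms[unfolded slotwise_linear_def]] add(1)] add(2) by blast
    have t: "xs[i := w] \<in> tuples V r" if "w \<in> carrier V" for w
      using add that by (simp add: tuples_update)
    note c = b_carrier[OF t]
    have l: "lin_map \<phi> (b (xs[i := w])) = b (ys[j := g w])" if "w \<in> carrier V" for w
      using lin_map_b[OF \<phi> t[OF that]] by (simp only: *(4)[OF that])
    have "lin_map \<phi> z = b (ys[j := g (x \<oplus>\<^bsub>V\<^esub> y)]) \<ominus>\<^bsub>F\<^esub> (b (ys[j := g x]) \<oplus>\<^bsub>F\<^esub> b (ys[j := g y]))"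
      by (simp only: add(5) Hom_minus[OF F_kspace F_kspace lm c F.add_closed[OF c c]]
          HomD(2)[OF lm c c] l add(3,4) add_closed)
    also have "\<dots> \<in> R"
      by (simp only: HomD(2)[OF *(3) add(3,4)] R_add[OF *(1,2) HomD(1)[OF *(3) add(3)] HomD(1)[OF *(3) add(4)]])
    finally show ?thesis .
  next
    case (smult xs i a x)
    obtain ys j g where *: "ys \<in> tuples V r" "j < r" "g \<in> Hom V V"
      "\<And>x. x \<in> carrier V \<Longrightarrow> \<phi> (xs[i := x]) = ys[j := g x]"
      using bspec[OF conjunct2[OF assms[unfolded slotwise_linear_def]] smult(1)] smult(2) by blast
    have t: "xs[i := w] \<in> tuples V r" if "w \<in> carrier V" for w
      using smult that by (simp add: tuples_update)
    note c = b_carrier[OF t]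
    have l: "lin_map \<phi> (b (xs[i := w])) = b (ys[j := g w])" if "w \<in> carrier V" for w
      using lin_map_b[OF \<phi> t[OF that]] by (simp only: *(4)[OF that])
    have "lin_map \<phi> z = b (ys[j := g (a \<odot>\<^bsub>V\<^esub> x)]) \<ominus>\<^bsub>F\<^esub> (a \<odot>\<^bsub>F\<^esub> b (ys[j := g x]))"
      by (simp only: smult(4) Hom_minus[OF F_kspace F_kspace lm c F.scale_closed[OF c]]
          HomD(3)[OF lm c] l smult(3) scale_closed)
    also have "\<dots> \<in> R"
      by (simp only: HomD(3)[OF *(3) smult(3)] R_smult[OF *(1,2) HomD(1)[OF *(3) smult(3)]])
    finally show ?thesis .
  qed
  have lmN: "lin_map \<phi> n \<in> N" if "n \<in> N" for n
    using that unfolding N_eq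
  proof induction
    case zero then show ?case
      using Hom_zero[OF F_kspace F_kspace lm] lspan.zero[of F R] by (simp del: F_simps)
  next
    case (base x) then show ?case by (auto intro: lspan.base lmR)
  next
    case (add x y) then show ?case
      using F.lspan_subset[OF R_carrier] by (simp add: HomD(2)[OF lm] subset_iff lspan.add del: F_simps)
  next
    case (smult x a) then show ?case
      using F.lspan_subset[OF R_carrier] by (simp add: HomD(3)[OF lm] subset_iff lspan.smult del: F_simps)
  qed
  show "tensor_map (class_ring :: 'k ring) r V \<phi> \<in> Hom T T"
    unfolding tm by (rule TQ.quot_map_Hom[OF lm lmN])
  show "tensor_map (class_ring :: 'k ring) r V \<phi> (pure_tensor V xs) = pure_tensor V (\<phi> xs)" if xs: "xs \<in> tuples V r"
    unfolding tm using TQ.quot_map_coset[OF lm lmN b_carrier[OF xs]]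
    by (simp only: pure_tensor_eq[OF xs] pure_tensor_eq[OF \<phi>[OF xs]] lin_map_b[OF \<phi> xs])
qed

lemma tensor_map_extensional:
  "tensor_map (class_ring :: 'k ring) r V \<phi> \<in> extensional (carrier T)"
  unfolding tensor_map_def Let_def by (rule TQ.quot_map_extensional)

text \<open>A product of linear forms, one per slot, is multilinear, so its linear extension kills
  the relations and lives on the tensor power.\<close>

lemma
  assumes \<Lambda>: "\<And>i. i < r \<Longrightarrow> linfun V (\<Lambda> i)"
  shows tensor_eval_linfun: "linfun T (tensor_eval \<Lambda>)"
    and tensor_eval_pure: "xs \<in> tuples V r \<Longrightarrow> tensor_eval \<Lambda> (pure_tensor V xs) = (\<Prod>i<r. \<Lambda> i (xs ! i))"
proof -
  let ?\<phi> = "\<lambda>xs. \<Prod>i<length xs. \<Lambda> i (xs ! i)"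
  \<comment> \<open>Only the factor of slot i depends on x; the remaining product is a constant that
    both kinds of relations share.\<close>
  have upd: "(\<Prod>j<length xs. \<Lambda> j (xs[i := x] ! j)) = \<Lambda> i x * (\<Prod>j\<in>{..<r} - {i}. \<Lambda> j (xs ! j))"
    if "xs \<in> tuples V r" "i < r" for xs i x
    using that by (simp add: tuples_iff prod.remove[of "{..<r}" i])
  have R0: "lin_ext ?\<phi> z = 0" if "z \<in> R" for z
    using that
  proof (cases rule: R_cases)
    case (add xs i x y)
    then have "b (xs[i := w]) \<in> carrier F" if "w \<in> carrier V" for w
      using that by (intro b_carrier tuples_update)
    then show ?thesis using add \<Lambda>[OF add(2)]
      by (simp add: linfun_minus[OF F_kspace linfun_lin_ext] linfunD(1)[OF linfun_lin_ext] lin_ext_b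
        F.add_closed upd linfunD distrib_right del: F_simps)
  next
    case (smult xs i a x)
    then have "b (xs[i := w]) \<in> carrier F" if "w \<in> carrier V" for w
      using that by (intro b_carrier tuples_update)
    then show ?thesis using smult \<Lambda>[OF smult(2)]
      by (simp add: linfun_minus[OF F_kspace linfun_lin_ext] linfunD(2)[OF linfun_lin_ext] lin_ext_b
        F.scale_closed upd linfunD del: F_simps)
  qed
  have N0: "lin_ext ?\<phi> n = 0" if "n \<in> N" for n
    using linfun_eq_on_lspan[OF F_kspace linfun_lin_ext linfun_const_zero R_carrier R0] that
    by (simp add: N_eq)
  note lq = TQ.linfun_quot[OF linfun_lin_ext N0]
  show "linfun T (tensor_eval \<Lambda>)"
    using lq(2) by (simp add: tensor_eval_def[abs_def])
  show "tensor_eval \<Lambda> (pure_tensor V xs) = (\<Prod>i<r. \<Lambda> i (xs ! i))" if xs: "xs \<in> tuples V r"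
    using lq(1)[OF _ b_carrier[OF xs]] xs
    by (simp add: tensor_eval_def pure_tensor_eq lin_ext_b tuples_def)
qed

text \<open>The factors are replaced by combinations of generators one at a time.\<close>

lemma T_lspan_gen:
  assumes S: "S \<subseteq> carrier V" "carrier V \<subseteq> lspan V S"
  shows "carrier T \<subseteq> lspan T (pure_tensor V ` {xs. length xs = r \<and> set xs \<subseteq> S})"
proof -
  let ?L = "lspan T (pure_tensor V ` {xs. length xs = r \<and> set xs \<subseteq> S})"
  \<comment> \<open>Slots from k on already hold generators. The induction step expands slot k and
    leaves k slots still arbitrary.\<close>
  have main: "k \<le> r \<Longrightarrow> xs \<in> tuples V r \<Longrightarrow> \<forall>i. k \<le> i \<and> i < r \<longrightarrow> xs ! i \<in> S \<Longrightarrow> pure_tensor V xs \<in> ?L" for k xs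
  proof (induction k arbitrary: xs)
    case 0
    then have "length xs = r" "set xs \<subseteq> S" by (auto simp: tuples_iff in_set_conv_nth)
    then show ?case by (auto intro: lspan.base)
  next
    case (Suc k)
    have k: "k < r" using Suc.prems by simp
    have t: "xs[k := x] \<in> tuples V r" if "x \<in> carrier V" for x
      using Suc.prems that by (simp add: tuples_update)
    have sub: "lspan V S \<subseteq> carrier V" by (rule lspan_subset[OF S(1)])
    have "pure_tensor V (xs[k := x]) \<in> ?L" if "x \<in> lspan V S" for x
      using that
    proof induction
      case zero
      \<comment> \<open>A zero factor is written as 0 times itself, so that the scalar can be pulled
        out of the tensor.\<close>
      have "pure_tensor V (xs[k := 0 \<odot>\<^bsub>V\<^esub> \<zero>\<^bsub>V\<^esub>]) = \<zero>\<^bsub>T\<^esub>"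
        using pure_tensor_smult[OF Suc.prems(2) k zero_closed, of 0]
          kspace.scale_0[OF T_kspace pure_tensor_closed[OF t[OF zero_closed]]] by simp
      then show ?case using lspan.zero[of T] by simp
    next
      case (base x)
      show ?case
        by (rule Suc.IH) (use Suc.prems base S k t in \<open>auto simp: nth_list_update tuples_iff\<close>)
    next
      case (add x y)
      then show ?case
        using sub Suc.prems k by (simp add: pure_tensor_add subset_iff lspan.add)
    next
      case (smult x a)
      then show ?case
        using sub Suc.prems k by (simp add: pure_tensor_smult subset_iff lspan.smult)
    qed
    moreover have "xs ! k \<in> lspan V S" using Suc.prems k S by (auto simp: tuples_iff)
    ultimately have "pure_tensor V (xs[k := xs ! k]) \<in> ?L" by blast
    then show ?case by simp
  qed
  have sub: "pure_tensor V ` tuples V r \<subseteq> ?L" by (auto intro!: main[of r])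
  show ?thesis by (rule subsetI) (rule lspan_trans[OF subsetD[OF T_lspan] sub])
qed

end

section \<open>Symmetric powers and their representations\<close>

text \<open>The conditions of \<open>linear_representation\<close> in a form that is easy to check.
  Bijectivity follows from inverses in G; extensionality is kept because a
  \<open>group_action\<close> maps into \<open>BijGroup\<close>.\<close>

definition krep :: "('k::field, 'v, 'm) module_scheme \<Rightarrow> ('g, 'b) monoid_scheme \<Rightarrow> ('g \<Rightarrow> 'v \<Rightarrow> 'v) \<Rightarrow> bool" where
  "krep V G \<rho> \<longleftrightarrow> kspace V \<and> group G \<and>
     (\<forall>g\<in>carrier G. \<rho> g \<in> Hom V V \<and> \<rho> g \<in> extensional (carrier V)) \<and>
     (\<forall>v\<in>carrier V. \<rho> \<one>\<^bsub>G\<^esub> v = v) \<and>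
     (\<forall>g\<in>carrier G. \<forall>h\<in>carrier G. \<forall>v\<in>carrier V. \<rho> (g \<otimes>\<^bsub>G\<^esub> h) v = \<rho> g (\<rho> h v))"

lemma krep_Hom: "krep V G \<rho> \<Longrightarrow> g \<in> carrier G \<Longrightarrow> \<rho> g \<in> Hom V V"
  by (simp add: krep_def)

lemma krep_linear_representation:
  fixes V :: "('k::field, 'v, 'm) module_scheme"
  assumes "krep V G \<rho>"
  shows "linear_representation (class_ring :: 'k ring) V G \<rho>"
proof -
  have V: "kspace V" and G: "group G"
    and hom: "\<And>g. g \<in> carrier G \<Longrightarrow> \<rho> g \<in> Hom V V"
    and ext: "\<And>g. g \<in> carrier G \<Longrightarrow> \<rho> g \<in> extensional (carrier V)"
    and one: "\<And>v. v \<in> carrier V \<Longrightarrow> \<rho> \<one>\<^bsub>G\<^esub> v = v"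
    and mult: "\<And>g h v. g \<in> carrier G \<Longrightarrow> h \<in> carrier G \<Longrightarrow> v \<in> carrier V \<Longrightarrow> \<rho> (g \<otimes>\<^bsub>G\<^esub> h) v = \<rho> g (\<rho> h v)"
    using assms by (auto simp: krep_def)
  interpret G: group G by (rule G)
  have inv: "\<rho> (inv\<^bsub>G\<^esub> g) (\<rho> g v) = v" "\<rho> g (\<rho> (inv\<^bsub>G\<^esub> g) v) = v"
    if "g \<in> carrier G" "v \<in> carrier V" for g v
    using mult[of "inv\<^bsub>G\<^esub> g" g v] mult[of g "inv\<^bsub>G\<^esub> g" v] that one by simp_all
  have bij: "bij_betw (\<rho> g) (carrier V) (carrier V)" if "g \<in> carrier G" for g
    by (rule bij_betwI[where g = "\<rho> (inv\<^bsub>G\<^esub> g)"]) (use that hom inv in \<open>auto dest: HomD(1)\<close>)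
  have "group_hom G (BijGroup (carrier V)) \<rho>"
  proof (intro group_hom.intro group_hom_axioms.intro G group_BijGroup homI)
    fix g assume "g \<in> carrier G"
    then show "\<rho> g \<in> carrier (BijGroup (carrier V))"
      using ext bij by (simp add: BijGroup_def Bij_def)
  next
    fix g h assume gh: "g \<in> carrier G" "h \<in> carrier G"
    then have "\<rho> (g \<otimes>\<^bsub>G\<^esub> h) = compose (carrier V) (\<rho> g) (\<rho> h)"
      by (intro extensionalityI[of _ "carrier V"]) (auto simp: ext mult compose_def)
    then show "\<rho> (g \<otimes>\<^bsub>G\<^esub> h) = \<rho> g \<otimes>\<^bsub>BijGroup (carrier V)\<^esub> \<rho> h"
      using gh ext bij by (simp add: BijGroup_def Bij_def)
  qed
  then have "group_action G (carrier V) \<rho>" by (rule group_action.intro)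
  then show ?thesis
    using V hom by (simp add: linear_representation_def linear_representation_axioms_def kspace_def)
qed

lemma slotwise_linear_map:
  assumes g: "g \<in> Hom V V"
  shows "slotwise_linear V r (map g)"
  unfolding slotwise_linear_def
proof (intro conjI ballI allI impI)
  fix xs i assume xs: "xs \<in> tuples V r" and i: "i < r"
  show "\<exists>ys\<in>tuples V r. \<exists>j<r. \<exists>ga\<in>Hom V V. \<forall>x\<in>carrier V. map g (xs[i := x]) = ys[j := ga x]"
    using g xs i tuples_map[OF xs HomD(1)[OF g]]
    by (intro bexI[of _ "map g xs"] exI[of _ i] conjI bexI[of _ g]) (auto simp: map_update)
qed (rule tuples_map[OF _ HomD(1)[OF g]])

lemma tuples_length: "xs \<in> tuples V r \<Longrightarrow> length xs = r"
  by (simp add: tuples_def)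

lemma tuples_permute: "xs \<in> tuples V r \<Longrightarrow> \<sigma> permutes {..<r} \<Longrightarrow> permute_list \<sigma> xs \<in> tuples V r"
  by (auto simp: tuples_def)

text \<open>Slot j of \<open>permute_list \<sigma> xs\<close> holds the entry with index \<sigma> j,
  so a change at index i appears in the slot that \<sigma> sends to i, with the identity as linear
  map.\<close>

lemma slotwise_linear_permute:
  assumes \<sigma>: "\<sigma> permutes {..<r}"
  shows "slotwise_linear V r (permute_list \<sigma>)"
  unfolding slotwise_linear_def
proof (intro conjI ballI allI impI)
  fix xs i assume xs: "xs \<in> tuples V r" and i: "i < r"
  have len: "length xs = r" using xs by (simp add: tuples_def)
  have invi: "inv_into UNIV \<sigma> i < r" using permutes_in_image[OF permutes_inv[OF \<sigma>], of i] i by simp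
  have *: "permute_list \<sigma> (xs[i := x]) = (permute_list \<sigma> xs)[inv_into UNIV \<sigma> i := x]" for x
  proof (rule nth_equalityI)
    fix j assume "j < length (permute_list \<sigma> (xs[i := x]))"
    then have j: "j < r" using len by simp
    then have "\<sigma> j < r" using permutes_in_image[OF \<sigma>, of j] by simp
    then show "permute_list \<sigma> (xs[i := x]) ! j = (permute_list \<sigma> xs)[inv_into UNIV \<sigma> i := x] ! j"
      using j i invi len \<sigma> permutes_inverses[OF \<sigma>] by (auto simp: permute_list_nth nth_list_update)
  qed simp
  have "(\<lambda>x. x) \<in> Hom V V" by (simp add: Hom_iff)
  then show "\<exists>ys\<in>tuples V r. \<exists>j<r. \<exists>g\<in>Hom V V. \<forall>x\<in>carrier V. permute_list \<sigma> (xs[i := x]) = ys[j := g x]"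
    using * invi tuples_permute[OF xs \<sigma>]
    by (intro bexI[of _ "permute_list \<sigma> xs"] exI[of _ "inv_into UNIV \<sigma> i"] conjI bexI[of _ "\<lambda>x. x"]) auto
qed (rule tuples_permute[OF _ \<sigma>])

text \<open>One form for all slots makes the value invariant under place permutations, and so lets
  it descend to the coinvariants.\<close>

definition sym_eval :: "('v \<Rightarrow> 'k::field poly) \<Rightarrow> ('v list \<Rightarrow> 'k) set set \<Rightarrow> 'k poly" where
  "sym_eval \<Lambda> Y = tensor_eval (\<lambda>_. \<Lambda>) (SOME X. X \<in> Y)"

context tensor
begin

abbreviation "tmap \<equiv> tensor_map (class_ring :: 'k ring) r V"
abbreviation "pperm \<equiv> place_perm (class_ring :: 'k ring) r V"

sublocale T: kspace T by (rule T_kspace)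

lemma pure_tensor_sub: "pure_tensor V ` tuples V r \<subseteq> carrier T"
  using pure_tensor_closed by auto

lemma T_Hom_eq:
  assumes "kspace W" "f \<in> Hom T W" "g \<in> Hom T W"
    "\<And>xs. xs \<in> tuples V r \<Longrightarrow> f (pure_tensor V xs) = g (pure_tensor V xs)" "w \<in> carrier T"
  shows "f w = g w"
  by (rule Hom_eq_on_lspan[OF T_kspace assms(1-3) pure_tensor_sub]) (use assms T_lspan in auto)

lemma T_linfun_eq:
  assumes "linfun T f" "linfun T g"
    "\<And>xs. xs \<in> tuples V r \<Longrightarrow> f (pure_tensor V xs) = g (pure_tensor V xs)" "w \<in> carrier T"
  shows "f w = g w"
  by (rule linfun_eq_on_lspan[OF T_kspace assms(1-2) pure_tensor_sub]) (use assms T_lspan in auto)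

lemmas tmap_Hom = tensor_map_Hom[OF slotwise_linear_map]
  and tmap_pure = tensor_map_pure[OF slotwise_linear_map]

lemma pperm_Hom: "\<sigma> permutes {..<r} \<Longrightarrow> pperm \<sigma> \<in> Hom T T"
  unfolding place_perm_def by (rule tensor_map_Hom[OF slotwise_linear_permute])

lemma pperm_pure:
  "\<sigma> permutes {..<r} \<Longrightarrow> xs \<in> tuples V r \<Longrightarrow> pperm \<sigma> (pure_tensor V xs) = pure_tensor V (permute_list \<sigma> xs)"
  unfolding place_perm_def by (rule tensor_map_pure[OF slotwise_linear_permute])

lemma tmap_pperm:
  assumes g: "g \<in> Hom V V" and \<sigma>: "\<sigma> permutes {..<r}" and w: "w \<in> carrier T"
  shows "tmap (map g) (pperm \<sigma> w) = pperm \<sigma> (tmap (map g) w)"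
  by (rule T_Hom_eq[OF T_kspace Hom_comp[OF pperm_Hom[OF \<sigma>] tmap_Hom[OF g]]
      Hom_comp[OF tmap_Hom[OF g] pperm_Hom[OF \<sigma>]] _ w])
    (simp add: pperm_pure[OF \<sigma>] tmap_pure[OF g] tuples_permute[OF _ \<sigma>] tuples_map[OF _ HomD(1)[OF g]]
      permute_list_map \<sigma> tuples_length)

text \<open>Acting on the tensor amounts to transposing the action onto the forms. This is the
  source of equivariance; both sides agree on pure tensors, factor by factor.\<close>

lemma tensor_eval_tmap:
  assumes g: "g \<in> Hom V V" and "\<And>i. i < r \<Longrightarrow> linfun V (\<Lambda> i)" "\<And>i. i < r \<Longrightarrow> linfun V (\<Lambda>' i)"
    and eq: "\<And>i x. i < r \<Longrightarrow> x \<in> carrier V \<Longrightarrow> \<Lambda> i (g x) = \<Lambda>' i x" and w: "w \<in> carrier T"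
  shows "tensor_eval \<Lambda> (tmap (map g) w) = tensor_eval \<Lambda>' w"
proof (rule T_linfun_eq[OF linfun_Hom[OF _ tmap_Hom[OF g]] _ _ w])
  fix xs assume xs: "xs \<in> tuples V r"
  then have "map g xs \<in> tuples V r" by (rule tuples_map) (rule HomD(1)[OF g])
  then show "tensor_eval \<Lambda> (tmap (map g) (pure_tensor V xs)) = tensor_eval \<Lambda>' (pure_tensor V xs)"
    using xs assms by (auto simp: tmap_pure tensor_eval_linfun tensor_eval_pure tuples_iff intro!: prod.cong)
qed (use assms tensor_eval_linfun in auto)

text \<open>Permuting the forms together with the factors only reorders a commutative
  product.\<close>

lemma tensor_eval_pperm:
  assumes \<sigma>: "\<sigma> permutes {..<r}" and \<Lambda>: "\<And>i. i < r \<Longrightarrow> linfun V (\<Lambda> i)" and w: "w \<in> carrier T"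
  shows "tensor_eval (\<lambda>i. \<Lambda> (\<sigma> i)) (pperm \<sigma> w) = tensor_eval \<Lambda> w"
proof -
  have s: "\<sigma> i < r" if "i < r" for i
    using permutes_in_image[OF \<sigma>, of i] that by simp
  show ?thesis
  proof (rule T_linfun_eq[OF linfun_Hom[OF _ pperm_Hom[OF \<sigma>]] _ _ w])
    fix xs assume xs: "xs \<in> tuples V r"
    have "(\<Prod>i<r. \<Lambda> (\<sigma> i) (permute_list \<sigma> xs ! i)) = (\<Prod>i<r. \<Lambda> (\<sigma> i) (xs ! \<sigma> i))"
      using xs \<sigma> by (intro prod.cong) (auto simp: tuples_def permute_list_nth)
    also have "\<dots> = (\<Prod>i<r. \<Lambda> i (xs ! i))"
      using prod.permute[OF \<sigma>, of "\<lambda>i. \<Lambda> i (xs ! i)"] by (simp add: o_def)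
    finally show "tensor_eval (\<lambda>i. \<Lambda> (\<sigma> i)) (pperm \<sigma> (pure_tensor V xs)) = tensor_eval \<Lambda> (pure_tensor V xs)"
      using xs \<sigma> \<Lambda> s by (simp add: pperm_pure tensor_eval_linfun tensor_eval_pure tuples_permute)
  qed (use \<Lambda> s tensor_eval_linfun in auto)
qed

section \<open>Invariants and coinvariants of a tensor power\<close>

definition "inv_tensors = {w \<in> carrier T. \<forall>\<sigma>. \<sigma> permutes {..<r} \<longrightarrow> pperm \<sigma> w = w}"

abbreviation "Sl \<equiv> T\<lparr>carrier := inv_tensors\<rparr>"

lemma inv_tensors_sub: "inv_tensors \<subseteq> carrier T"
  by (auto simp: inv_tensors_def)

lemma Sl_kspace: "kspace Sl"
  by (rule T.subspace_kspace)
    (auto simp: inv_tensors_def HomD[OF pperm_Hom] Hom_zero[OF T_kspace T_kspace pperm_Hom])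

lemma Sl_Hom: "f \<in> Hom T T \<Longrightarrow> (\<And>w. w \<in> inv_tensors \<Longrightarrow> f w \<in> inv_tensors) \<Longrightarrow> restrict f inv_tensors \<in> Hom Sl Sl"
  using kspace.add_closed[OF Sl_kspace] kspace.scale_closed[OF Sl_kspace] inv_tensors_sub
  by (intro HomI) (auto simp: HomD subset_iff)

lemma Sl_linfun: "linfun T f \<Longrightarrow> linfun Sl f"
  using inv_tensors_sub by (auto simp: linfun_def subset_iff)

definition "sym_rels = {pperm \<sigma> w \<ominus>\<^bsub>T\<^esub> w | \<sigma> w. \<sigma> permutes {..<r} \<and> w \<in> carrier T}"
definition "NS = lspan T sym_rels"

lemma sym_relsI: "\<sigma> permutes {..<r} \<Longrightarrow> w \<in> carrier T \<Longrightarrow> pperm \<sigma> w \<ominus>\<^bsub>T\<^esub> w \<in> sym_rels"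
  unfolding sym_rels_def by blast

lemma sym_relsE:
  assumes "n \<in> sym_rels"
  obtains \<sigma> w where "\<sigma> permutes {..<r}" "w \<in> carrier T" "n = pperm \<sigma> w \<ominus>\<^bsub>T\<^esub> w"
  using assms unfolding sym_rels_def by blast

abbreviation "Su \<equiv> quot_module T NS"

lemma sym_rels_sub: "sym_rels \<subseteq> carrier T"
  by (auto simp: sym_rels_def HomD[OF pperm_Hom])

sublocale SQ: kquot T NS
  unfolding NS_def by (rule T.kquot_lspan[OF sym_rels_sub])

lemma span_sym_rels:
  "LinearCombinations.module.span (class_ring :: 'k ring) T
     {pperm \<sigma> w \<ominus>\<^bsub>T\<^esub> w | \<sigma> w. \<sigma> permutes {..<r} \<and> w \<in> carrier T} = NS"
  unfolding NS_def using T.span_eq_lspan[OF sym_rels_sub] by (simp add: sym_rels_def)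

lemma tmap_NS:
  assumes g: "g \<in> Hom V V" and n: "n \<in> NS"
  shows "tmap (map g) n \<in> NS"
  using n unfolding NS_def
proof induction
  case zero
  then show ?case by (simp add: Hom_zero[OF T_kspace T_kspace tmap_Hom[OF g]] lspan.zero)
next
  case (base x)
  then obtain \<sigma> w where *: "\<sigma> permutes {..<r}" "w \<in> carrier T" "x = pperm \<sigma> w \<ominus>\<^bsub>T\<^esub> w"
    by (rule sym_relsE)
  have "tmap (map g) x = pperm \<sigma> (tmap (map g) w) \<ominus>\<^bsub>T\<^esub> tmap (map g) w"
    using * by (simp add: Hom_minus[OF T_kspace T_kspace tmap_Hom[OF g]] HomD(1)[OF pperm_Hom] tmap_pperm g)
  then show ?case
    using * HomD(1)[OF tmap_Hom[OF g]] by (simp add: lspan.base sym_relsI)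
next
  case (add x y)
  then show ?case
    using T.lspan_subset[OF sym_rels_sub] by (simp add: HomD(2)[OF tmap_Hom[OF g]] subset_iff lspan.add)
next
  case (smult x a)
  then show ?case
    using T.lspan_subset[OF sym_rels_sub] by (simp add: HomD(3)[OF tmap_Hom[OF g]] subset_iff lspan.smult)
qed

text \<open>The commutative product of the entries of \<open>xs\<close> in the symmetric
  power.\<close>

definition "sprod xs = NS +>\<^bsub>T\<^esub> pure_tensor V xs"

lemma sprod_closed: "xs \<in> tuples V r \<Longrightarrow> sprod xs \<in> carrier Su"
  by (auto simp: sprod_def SQ.quot_carrier pure_tensor_closed)

lemma sprod_permute:
  assumes "\<sigma> permutes {..<r}" "xs \<in> tuples V r"
  shows "sprod (permute_list \<sigma> xs) = sprod xs"
proof -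
  have "pperm \<sigma> (pure_tensor V xs) \<ominus>\<^bsub>T\<^esub> pure_tensor V xs \<in> NS"
    unfolding NS_def using assms by (intro lspan.base sym_relsI pure_tensor_closed)
  then show ?thesis
    using assms by (simp add: sprod_def SQ.coset_eq_iff pure_tensor_closed tuples_permute pperm_pure)
qed

lemma Su_map_sprod:
  "g \<in> Hom V V \<Longrightarrow> xs \<in> tuples V r \<Longrightarrow> quot_map T NS (tmap (map g)) (sprod xs) = sprod (map g xs)"
  unfolding sprod_def using SQ.quot_map_coset[OF tmap_Hom tmap_NS pure_tensor_closed] by (simp add: tmap_pure)

lemma Su_map_Hom: "g \<in> Hom V V \<Longrightarrow> quot_map T NS (tmap (map g)) \<in> Hom Su Su"
  by (rule SQ.quot_map_Hom[OF tmap_Hom tmap_NS])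

lemma Su_lspan_gen:
  assumes S: "S \<subseteq> carrier V" "carrier V \<subseteq> lspan V S"
  shows "carrier Su \<subseteq> lspan Su (sprod ` {xs. length xs = r \<and> set xs \<subseteq> S})"
proof -
  have "{xs. length xs = r \<and> set xs \<subseteq> S} \<subseteq> tuples V r" using S by (auto simp: tuples_def)
  then have "pure_tensor V ` {xs. length xs = r \<and> set xs \<subseteq> S} \<subseteq> carrier T"
    using pure_tensor_closed by blast
  from SQ.quot_lspan[OF T_lspan_gen[OF S] this] show ?thesis
    by (simp add: image_image sprod_def)
qed

lemma Su_lspan: "carrier Su \<subseteq> lspan Su (sprod ` tuples V r)"
proof -
  have "carrier V \<subseteq> lspan V (carrier V)" by (auto intro: lspan.base)
  from Su_lspan_gen[OF subset_refl this] show ?thesis by (simp add: tuples_def)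
qed

text \<open>A product in the symmetric power does not depend on the order of its factors, so sorted
  lists of indices, standing for multisets, suffice as generators.\<close>

lemma Su_lspan_sorted:
  assumes s: "\<And>k. k \<le> n \<Longrightarrow> s k \<in> carrier V" and gen: "carrier V \<subseteq> lspan V (s ` {..n})"
  shows "carrier Su \<subseteq> lspan Su ((\<lambda>ks. sprod (map s ks)) ` {ks. length ks = r \<and> sorted ks \<and> set ks \<subseteq> {..n::nat}})"
proof -
  have "sprod xs \<in> (\<lambda>ks. sprod (map s ks)) ` {ks. length ks = r \<and> sorted ks \<and> set ks \<subseteq> {..n}}"
    if xs: "length xs = r" "set xs \<subseteq> s ` {..n}" for xs
  proof -
    define ks where "ks = map (inv_into {..n} s) xs"
    have "inv_into {..n} s x \<in> {..n} \<and> s (inv_into {..n} s x) = x" if "x \<in> set xs" for x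
      using that xs(2) inv_into_into[of x s "{..n}"] f_inv_into_f[of x s "{..n}"] by auto
    then have ks: "xs = map s ks" "set ks \<subseteq> {..n}"
      by (auto simp: ks_def intro!: map_idI[symmetric])
    obtain \<sigma> where \<sigma>: "\<sigma> permutes {..<length ks}" "permute_list \<sigma> ks = sort ks"
      using mset_eq_permutation[of "sort ks" ks] by auto
    have "sprod (map s (sort ks)) = sprod (permute_list \<sigma> xs)"
      using \<sigma> ks by (simp add: permute_list_map flip: \<sigma>(2))
    also have "\<dots> = sprod xs"
      using \<sigma> ks xs s by (intro sprod_permute) (auto simp: tuples_def)
    finally show ?thesis
      using ks xs by (intro image_eqI[of _ _ "sort ks"]) auto
  qed
  then have "sprod ` {xs. length xs = r \<and> set xs \<subseteq> s ` {..n}} \<subseteq>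
      (\<lambda>ks. sprod (map s ks)) ` {ks. length ks = r \<and> sorted ks \<and> set ks \<subseteq> {..n}}" by auto
  then have *: "sprod ` {xs. length xs = r \<and> set xs \<subseteq> s ` {..n}} \<subseteq>
      lspan Su ((\<lambda>ks. sprod (map s ks)) ` {ks. length ks = r \<and> sorted ks \<and> set ks \<subseteq> {..n}})"
    by (rule subset_trans) (rule subsetI, rule lspan.base)
  have "s ` {..n} \<subseteq> carrier V" using s by auto
  note sub = Su_lspan_gen[OF this gen]
  show ?thesis
    by (rule subsetI, rule lspan_trans[OF _ *], rule subsetD[OF sub])
qed

text \<open>By \<open>tensor_eval_pperm\<close> with equal forms, a tensor and its place
  permutations have the same value, so the relations of the coinvariants evaluate to zero.\<close>

lemma
  assumes \<Lambda>: "linfun V \<Lambda>"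
  shows sym_eval_linfun: "linfun Su (sym_eval \<Lambda>)"
    and sym_eval_sprod: "xs \<in> tuples V r \<Longrightarrow> sym_eval \<Lambda> (sprod xs) = (\<Prod>i<r. \<Lambda> (xs ! i))"
proof -
  let ?f = "tensor_eval (\<lambda>_. \<Lambda>)"
  have f: "linfun T ?f" by (rule tensor_eval_linfun) (rule \<Lambda>)
  have R0: "?f n = 0" if n: "n \<in> sym_rels" for n
  proof -
    obtain \<sigma> w where *: "\<sigma> permutes {..<r}" "w \<in> carrier T" "n = pperm \<sigma> w \<ominus>\<^bsub>T\<^esub> w"
      using n by (rule sym_relsE)
    then show ?thesis
      using tensor_eval_pperm[OF *(1), of "\<lambda>_. \<Lambda>" w] \<Lambda>
      by (simp add: linfun_minus[OF T_kspace f] HomD(1)[OF pperm_Hom])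
  qed
  have N0: "?f n = 0" if "n \<in> NS" for n
    using linfun_eq_on_lspan[OF T_kspace f linfun_const_zero sym_rels_sub R0] that by (simp add: NS_def)
  note lq = SQ.linfun_quot[OF f N0]
  show "linfun Su (sym_eval \<Lambda>)"
    using lq(2) by (simp add: sym_eval_def[abs_def])
  show "sym_eval \<Lambda> (sprod xs) = (\<Prod>i<r. \<Lambda> (xs ! i))" if "xs \<in> tuples V r"
    using lq(1)[OF _ pure_tensor_closed[OF that]] tensor_eval_pure[of "\<lambda>_. \<Lambda>" xs] \<Lambda> that
    by (simp add: sym_eval_def sprod_def)
qed

lemma sprod_sub: "sprod ` tuples V r \<subseteq> carrier Su"
  using sprod_closed by auto

lemma sym_eval_map:
  assumes g: "g \<in> Hom V V" and \<Lambda>: "linfun V \<Lambda>" and \<Lambda>': "linfun V \<Lambda>'"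
    and eq: "\<And>x. x \<in> carrier V \<Longrightarrow> \<Lambda> (g x) = \<Lambda>' x" and Y: "Y \<in> carrier Su"
  shows "sym_eval \<Lambda> (quot_map T NS (tmap (map g)) Y) = sym_eval \<Lambda>' Y"
proof (rule linfun_eq_on_lspan[OF SQ.quot_kspace linfun_Hom[OF sym_eval_linfun[OF \<Lambda>] Su_map_Hom[OF g]]
      sym_eval_linfun[OF \<Lambda>'] sprod_sub])
  fix X assume "X \<in> sprod ` tuples V r"
  then obtain xs where xs: "xs \<in> tuples V r" "X = sprod xs" by auto
  have "map g xs \<in> tuples V r" by (rule tuples_map[OF xs(1) HomD(1)[OF g]])
  then show "sym_eval \<Lambda> (quot_map T NS (tmap (map g)) X) = sym_eval \<Lambda>' X"
    using xs(1) eq unfolding xs(2) Su_map_sprod[OF g xs(1)] sym_eval_sprod[OF \<Lambda>'  xs(1)]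
    by (subst sym_eval_sprod[OF \<Lambda>]) (auto simp: tuples_iff intro!: prod.cong)
qed (use Y Su_lspan in auto)

section \<open>Group actions on tensor powers, invariants and coinvariants\<close>

lemma tmap_one:
  assumes g: "g \<in> Hom V V" "\<And>v. v \<in> carrier V \<Longrightarrow> g v = v" and w: "w \<in> carrier T"
  shows "tmap (map g) w = w"
proof (rule T_Hom_eq[OF T_kspace tmap_Hom[OF g(1)] Hom_id _ w])
  fix xs assume xs: "xs \<in> tuples V r"
  then have "map g xs = xs" by (auto simp: tuples_def g(2) subset_iff intro: map_idI)
  then show "tmap (map g) (pure_tensor V xs) = pure_tensor V xs" using xs by (simp add: tmap_pure[OF g(1)])
qed

lemma tmap_comp:
  assumes g: "g \<in> Hom V V" and h: "h \<in> Hom V V" and k: "k \<in> Hom V V"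
    and eq: "\<And>v. v \<in> carrier V \<Longrightarrow> k v = g (h v)" and w: "w \<in> carrier T"
  shows "tmap (map k) w = tmap (map g) (tmap (map h) w)"
proof (rule T_Hom_eq[OF T_kspace tmap_Hom[OF k] Hom_comp[OF tmap_Hom[OF h] tmap_Hom[OF g]] _ w])
  fix xs assume xs: "xs \<in> tuples V r"
  then have "map k xs = map g (map h xs)" by (auto simp: tuples_def eq subset_iff)
  then show "tmap (map k) (pure_tensor V xs) = tmap (map g) (tmap (map h) (pure_tensor V xs))"
    using xs tuples_map[OF xs HomD(1)[OF h]] by (simp add: tmap_pure g h k del: map_map)
qed

lemma tensor_krep:
  assumes "krep V G \<rho>"
  shows "krep T G (\<lambda>g. tmap (map (\<rho> g)))"
proof -
  have G: "group G" using assms by (simp add: krep_def)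
  interpret G: group G by (rule G)
  show ?thesis
    unfolding krep_def
    by (intro conjI ballI T_kspace G tmap_Hom tensor_map_extensional tmap_one tmap_comp)
      (use assms in \<open>auto simp: krep_def\<close>)
qed

lemma Sl_krep:
  assumes \<rho>: "krep V G \<rho>"
  shows "krep Sl G (\<lambda>g. restrict (tmap (map (\<rho> g))) inv_tensors)"
proof -
  note T = tensor_krep[OF \<rho>, unfolded krep_def]
  have hom: "\<rho> g \<in> Hom V V" if "g \<in> carrier G" for g using \<rho> that by (simp add: krep_def)
  have closed: "tmap (map (\<rho> g)) w \<in> inv_tensors" if g: "g \<in> carrier G" and w: "w \<in> inv_tensors" for g w
    using w HomD(1)[OF tmap_Hom[OF hom[OF g]]] by (auto simp: inv_tensors_def tmap_pperm[OF hom[OF g], symmetric])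
  have w: "w \<in> carrier T" if "w \<in> inv_tensors" for w using that inv_tensors_sub by auto
  have "\<one>\<^bsub>G\<^esub> \<in> carrier G" "\<And>g h. g \<in> carrier G \<Longrightarrow> h \<in> carrier G \<Longrightarrow> g \<otimes>\<^bsub>G\<^esub> h \<in> carrier G"
    using T by (simp_all add: group.is_monoid monoid.one_closed monoid.m_closed)
  then show ?thesis
    unfolding krep_def using T by (simp add: Sl_kspace closed w Sl_Hom)
qed

lemma Su_krep:
  assumes \<rho>: "krep V G \<rho>"
  shows "krep Su G (\<lambda>g. quot_map T NS (tmap (map (\<rho> g))))"
proof -
  note T = tensor_krep[OF \<rho>, unfolded krep_def]
  have hom: "\<rho> g \<in> Hom V V" if "g \<in> carrier G" for g using \<rho> that by (simp add: krep_def)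
  have ap: "quot_map T NS (tmap (map (\<rho> g))) (NS +>\<^bsub>T\<^esub> w) = NS +>\<^bsub>T\<^esub> tmap (map (\<rho> g)) w"
    if "g \<in> carrier G" "w \<in> carrier T" for g w
    by (rule SQ.quot_map_coset[OF tmap_Hom[OF hom[OF that(1)]] tmap_NS[OF hom[OF that(1)]] that(2)])
  have closed: "tmap (map (\<rho> g)) w \<in> carrier T" if "g \<in> carrier G" "w \<in> carrier T" for g w
    using HomD(1)[OF tmap_Hom[OF hom[OF that(1)]] that(2)] .
  have "\<one>\<^bsub>G\<^esub> \<in> carrier G" "\<And>g h. g \<in> carrier G \<Longrightarrow> h \<in> carrier G \<Longrightarrow> g \<otimes>\<^bsub>G\<^esub> h \<in> carrier G"
    using T by (simp_all add: group.is_monoid monoid.one_closed monoid.m_closed)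
  then show ?thesis
    unfolding krep_def using T
    by (auto simp: SQ.quot_kspace SQ.quot_map_extensional[unfolded SQ.quot_carrier] SQ.quot_carrier ap closed intro: Su_map_Hom[OF hom])
qed

end

lemma Sym_lower_eq:
  fixes V :: "('k::field, 'v) module"
  assumes "kspace V"
  shows "Sym_lower (class_ring :: 'k ring) r (V, \<rho>) = (tensor_power (class_ring :: 'k ring) r V\<lparr>carrier := tensor.inv_tensors V r\<rparr>,
    \<lambda>g. restrict (tensor_map (class_ring :: 'k ring) r V (map (\<rho> g))) (tensor.inv_tensors V r))"
proof -
  interpret tensor V r using assms by (rule tensor.intro)
  show ?thesis by (simp add: Sym_lower_def tensor_rep_def Let_def inv_tensors_def)
qed

lemma Sym_upper_eq:
  fixes V :: "('k::field, 'v) module"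
  assumes "kspace V"
  shows "Sym_upper (class_ring :: 'k ring) r (V, \<rho>) = (quot_module (tensor_power (class_ring :: 'k ring) r V) (tensor.NS V r),
    \<lambda>g. quot_map (tensor_power (class_ring :: 'k ring) r V) (tensor.NS V r) (tensor_map (class_ring :: 'k ring) r V (map (\<rho> g))))"
proof -
  interpret tensor V r using assms by (rule tensor.intro)
  show ?thesis unfolding Sym_upper_def tensor_rep_def Let_def split_conv span_sym_rels by simp
qed

section \<open>Degrees at the Kronecker point\<close>

text \<open>The list read as digits in base N, least significant first: the degree at the Kronecker
  point of the monomial with these exponents.\<close>

definition base_value :: "nat \<Rightarrow> nat list \<Rightarrow> nat" where
  "base_value N a = (\<Sum>i<length a. a ! i * N ^ i)"

lemma base_value_Cons: "base_value N (x # a) = x + N * base_value N a"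
  by (simp add: base_value_def sum.lessThan_Suc_shift sum_distrib_left mult_ac del: sum.lessThan_Suc)

lemma base_value_inj:
  assumes "length a = length b" "\<forall>x\<in>set a. x < N" "\<forall>x\<in>set b. x < N" "base_value N a = base_value N b"
  shows "a = b"
  using assms
proof (induction a b rule: list_induct2)
  case (Cons x a y b)
  have "(x + N * base_value N a) mod N = (y + N * base_value N b) mod N" "(x + N * base_value N a) div N = (y + N * base_value N b) div N"
    using Cons.prems by (simp_all add: base_value_Cons)
  then have "x = y" "base_value N a = base_value N b" using Cons.prems by auto
  then show ?case using Cons by simp
qed simp

lemma prod_monom: "(\<Prod>i\<in>A. monom (1 :: 'a::comm_semiring_1) (g i)) = monom 1 (\<Sum>i\<in>A. g i)"
  by (induction A rule: infinite_finite_induct) (simp_all add: mult_monom)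

text \<open>The rearrangement inequality: the larger entry moves to the larger weight, and the gain
  is \<open>(a ! i - a ! j) * (N ^ j - N ^ i)\<close>.\<close>

lemma base_value_swap:
  assumes ij: "i < j" "j < length a" and a: "a ! j < a ! i" and N: "2 \<le> N"
  shows "base_value N a < base_value N (permute_list (Transposition.transpose i j) a)"
proof -
  let ?\<sigma> = "Transposition.transpose i j" and ?m = "length a"
  let ?R = "{..<?m} - {i, j}"
  have \<sigma>: "?\<sigma> permutes {..<?m}" using ij by (intro permutes_swap_id) auto
  have split: "(\<Sum>k<?m. h k) = h i + h j + (\<Sum>k\<in>?R. h k)" for h :: "nat \<Rightarrow> nat"
  proof -
    have "{..<?m} = insert i (insert j ?R)" using ij by auto
    then have "(\<Sum>k<?m. h k) = (\<Sum>k\<in>insert i (insert j ?R). h k)" by simp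
    also have "\<dots> = h i + h j + (\<Sum>k\<in>?R. h k)" using ij by simp
    finally show ?thesis .
  qed
  have "base_value N (permute_list ?\<sigma> a) = (\<Sum>k<?m. a ! ?\<sigma> k * N ^ k)"
    using \<sigma> by (auto simp: base_value_def permute_list_nth)
  also have "\<dots> = a ! j * N ^ i + a ! i * N ^ j + (\<Sum>k\<in>?R. a ! k * N ^ k)"
    unfolding split by (intro arg_cong2[of _ _ _ _ "(+)"] sum.cong) (auto simp: transpose_def)
  finally have 1: "base_value N (permute_list ?\<sigma> a) = a ! j * N ^ i + a ! i * N ^ j + (\<Sum>k\<in>?R. a ! k * N ^ k)" .
  have 2: "base_value N a = a ! i * N ^ i + a ! j * N ^ j + (\<Sum>k\<in>?R. a ! k * N ^ k)"
    unfolding base_value_def split ..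
  have "N ^ i < N ^ j" using ij N by (intro power_strict_increasing) auto
  then obtain q where q: "N ^ j = N ^ i + q" "0 < q" using less_imp_add_positive by metis
  obtain p where p: "a ! i = a ! j + p" "0 < p" using a less_imp_add_positive by metis
  show ?thesis using p(2) q(2) unfolding 1 2 p q by (simp add: algebra_simps)
qed


section \<open>Coordinates in a span and separation by degree\<close>

lemma lspan_insert:
  assumes V: "kspace V" and A: "insert v A \<subseteq> carrier V" and x: "x \<in> lspan V (insert v A)"
  shows "\<exists>c. \<exists>y\<in>lspan V A. x = c \<odot>\<^bsub>V\<^esub> v \<oplus>\<^bsub>V\<^esub> y"
proof -
  interpret kspace V by (rule V)
  have sub: "lspan V A \<subseteq> carrier V" using A by (intro lspan_subset) auto
  have v: "v \<in> carrier V" using A by simp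
  from x show ?thesis
  proof induction
    case zero
    show ?case using v by (intro exI[of _ 0] bexI[of _ "\<zero>\<^bsub>V\<^esub>"]) (auto intro: lspan.zero)
  next
    case (base x)
    then consider "x = v" | "x \<in> A" by auto
    then show ?case
    proof cases
      case 1 then show ?thesis using v by (intro exI[of _ 1] bexI[of _ "\<zero>\<^bsub>V\<^esub>"]) (auto intro: lspan.zero)
    next
      case 2 then show ?thesis using v A by (intro exI[of _ 0] bexI[of _ x]) (auto intro: lspan.base)
    qed
  next
    case (add x y)
    then obtain c x' d y' where *: "x' \<in> lspan V A" "x = c \<odot>\<^bsub>V\<^esub> v \<oplus>\<^bsub>V\<^esub> x'" "y' \<in> lspan V A" "y = d \<odot>\<^bsub>V\<^esub> v \<oplus>\<^bsub>V\<^esub> y'"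
      by blast
    then have "x' \<in> carrier V" "y' \<in> carrier V" using sub by auto
    then have "x \<oplus>\<^bsub>V\<^esub> y = (c + d) \<odot>\<^bsub>V\<^esub> v \<oplus>\<^bsub>V\<^esub> (x' \<oplus>\<^bsub>V\<^esub> y')"
      using v by (simp add: * scale_add_left add_assoc add_left_comm[of x' "d \<odot>\<^bsub>V\<^esub> v" y'])
    then show ?case using lspan.add[OF *(1,3)] by blast
  next
    case (smult x a)
    then obtain c x' where *: "x' \<in> lspan V A" "x = c \<odot>\<^bsub>V\<^esub> v \<oplus>\<^bsub>V\<^esub> x'" by blast
    then have "a \<odot>\<^bsub>V\<^esub> x = (a * c) \<odot>\<^bsub>V\<^esub> v \<oplus>\<^bsub>V\<^esub> a \<odot>\<^bsub>V\<^esub> x'"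
      using v sub by (simp add: scale_add_right scale_scale subset_iff)
    then show ?case using lspan.smult[OF *(1)] by blast
  qed
qed

lemma lspan_empty: "kspace V \<Longrightarrow> x \<in> lspan V {} \<Longrightarrow> x = \<zero>\<^bsub>V\<^esub>"
  by (rotate_tac, induction rule: lspan.induct) (auto simp: kspace.zero_closed kspace.l_zero kspace.scale_zero)

text \<open>The coefficients are chosen before the functional L, so that the same c serves several
  functionals; \<open>leading_exponent\<close> compares two of them. Indexing c by A rather than by
  the vectors allows f to repeat values.\<close>

lemma lspan_coords:
  fixes V :: "('k::field, 'v, 'm) module_scheme"
  assumes V: "kspace V" and "finite A" "f ` A \<subseteq> carrier V" "x \<in> lspan V (f ` A)"
  shows "\<exists>c. (\<forall>L. linfun V L \<longrightarrow> L x = (\<Sum>a\<in>A. Polynomial.smult (c a) (L (f a)))) \<and>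
    ((\<forall>a\<in>A. c a = 0) \<longrightarrow> x = \<zero>\<^bsub>V\<^esub>)"
  using assms(2-)
proof (induction A arbitrary: x rule: finite_induct)
  case empty
  then show ?case using lspan_empty[OF V] linfun_zero[OF V] by auto
next
  case (insert v A)
  interpret kspace V by (rule V)
  obtain k y where y: "y \<in> lspan V (f ` A)" "x = k \<odot>\<^bsub>V\<^esub> f v \<oplus>\<^bsub>V\<^esub> y"
    using lspan_insert[OF V, of "f v" "f ` A" x] insert.prems by auto
  have cy: "y \<in> carrier V" using y(1) insert.prems lspan_subset[of "f ` A"] by auto
  obtain c where c: "\<And>L. linfun V L \<Longrightarrow> L y = (\<Sum>a\<in>A. Polynomial.smult (c a) (L (f a)))"
    "(\<forall>a\<in>A. c a = 0) \<longrightarrow> y = \<zero>\<^bsub>V\<^esub>"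
    using insert.IH[OF _ y(1)] insert.prems by auto
  let ?c = "c(v := k)"
  have "L x = (\<Sum>a\<in>insert v A. Polynomial.smult (?c a) (L (f a)))" if L: "linfun V L" for L
  proof -
    have "(\<Sum>a\<in>A. Polynomial.smult (?c a) (L (f a))) = (\<Sum>a\<in>A. Polynomial.smult (c a) (L (f a)))"
      using insert.hyps by (intro sum.cong) auto
    then show ?thesis
      using insert.hyps insert.prems cy by (simp add: y(2) linfunD[OF L] c(1)[OF L])
  qed
  moreover have "x = \<zero>\<^bsub>V\<^esub>" if "\<forall>a\<in>insert v A. ?c a = 0"
  proof -
    have "k = 0" "\<forall>a\<in>A. c a = 0" using that insert.hyps by (auto split: if_splits)
    then show ?thesis using c(2) insert.prems by (simp add: y(2))
  qed
  ultimately show ?case by blast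
qed

text \<open>Among the indices with nonzero coefficient, the one of largest degree is alone in
  contributing to that coefficient of \<open>L x\<close>, so nothing can cancel it.\<close>

lemma linfun_inj_by_degree:
  fixes V :: "('k::field, 'v, 'm) module_scheme"
  assumes V: "kspace V" and A: "finite A" "f ` A \<subseteq> carrier V" and x: "x \<in> lspan V (f ` A)"
    and L: "linfun V L" and nz: "\<And>a. a \<in> A \<Longrightarrow> L (f a) \<noteq> 0"
    and inj: "inj_on (\<lambda>a. degree (L (f a))) A" and Lx: "L x = 0"
  shows "x = \<zero>\<^bsub>V\<^esub>"
proof -
  obtain c where c: "L x = (\<Sum>a\<in>A. Polynomial.smult (c a) (L (f a)))" "(\<forall>a\<in>A. c a = 0) \<longrightarrow> x = \<zero>\<^bsub>V\<^esub>"
    using lspan_coords[OF V A x] L by blast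
  have "\<forall>a\<in>A. c a = 0"
  proof (rule ccontr)
    assume "\<not> (\<forall>a\<in>A. c a = 0)"
    then have ne: "{a\<in>A. c a \<noteq> 0} \<noteq> {}" by auto
    have "finite {a\<in>A. c a \<noteq> 0}" using A by auto
    define M where "M = Max ((\<lambda>a. degree (L (f a))) ` {a\<in>A. c a \<noteq> 0})"
    have "M \<in> (\<lambda>a. degree (L (f a))) ` {a\<in>A. c a \<noteq> 0}"
      unfolding M_def using \<open>finite {a\<in>A. c a \<noteq> 0}\<close> ne by (intro Max_in) auto
    then obtain a where "a \<in> A" "c a \<noteq> 0" "M = degree (L (f a))" by auto
    moreover have "degree (L (f b)) \<le> M" if "b \<in> A" "c b \<noteq> 0" for b
      unfolding M_def using \<open>finite {a\<in>A. c a \<noteq> 0}\<close> that by (intro Max_ge) auto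
    ultimately have a: "a \<in> A" "c a \<noteq> 0"
      "\<And>b. b \<in> A \<Longrightarrow> c b \<noteq> 0 \<Longrightarrow> degree (L (f b)) \<le> degree (L (f a))" by auto
    let ?D = "degree (L (f a))"
    have "coeff (L x) ?D = (\<Sum>b\<in>A. c b * coeff (L (f b)) ?D)"
      by (simp add: c(1) coeff_sum)
    also have "\<dots> = c a * coeff (L (f a)) ?D"
    proof (subst sum.remove[OF A(1) a(1)], intro trans[OF arg_cong2[of _ _ _ _ "(+)", OF refl sum.neutral]])
      show "\<forall>b\<in>A - {a}. c b * coeff (L (f b)) ?D = 0"
      proof
        fix b assume b: "b \<in> A - {a}"
        show "c b * coeff (L (f b)) ?D = 0"
        proof (cases "c b = 0")
          case False
          then have "degree (L (f b)) < ?D"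
            using a(3)[of b] b inj_onD[OF inj, of a b] a(1) by (auto simp: le_less)
          then show ?thesis by (simp add: coeff_eq_0)
        qed simp
      qed
    qed simp
    finally show False using a nz[OF a(1)] Lx by simp
  qed
  then show ?thesis using c(2) by simp
qed


section \<open>Functions homogeneous of the same degree in every point\<close>

inductive_set multihomogeneous :: "nat \<Rightarrow> nat \<Rightarrow> ((nat \<Rightarrow> 'k::field poly \<times> 'k poly) \<Rightarrow> 'k poly) set"
  for m d
  where
    mono: "(\<And>i. i < m \<Longrightarrow> a i \<le> d) \<Longrightarrow> (\<lambda>pt. \<Prod>i<m. fst (pt i) ^ a i * snd (pt i) ^ (d - a i)) \<in> multihomogeneous m d"
  | zero: "(\<lambda>_. 0) \<in> multihomogeneous m d"
  | add: "F \<in> multihomogeneous m d \<Longrightarrow> G \<in> multihomogeneous m d \<Longrightarrow> (\<lambda>pt. F pt + G pt) \<in> multihomogeneous m d"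
  | smult: "F \<in> multihomogeneous m d \<Longrightarrow> (\<lambda>pt. Polynomial.smult c (F pt)) \<in> multihomogeneous m d"

lemma multihomogeneous_sum: "finite A \<Longrightarrow> (\<And>a. a \<in> A \<Longrightarrow> F a \<in> multihomogeneous m d) \<Longrightarrow> (\<lambda>pt. \<Sum>a\<in>A. F a pt) \<in> multihomogeneous m d"
  by (induction A rule: finite_induct) (auto intro: multihomogeneous.zero multihomogeneous.add)

lemma multihomogeneous_mono_mult:
  assumes a: "\<And>i. i < m \<Longrightarrow> a i \<le> d" and G: "G \<in> multihomogeneous m e"
  shows "(\<lambda>pt. (\<Prod>i<m. fst (pt i) ^ a i * snd (pt i) ^ (d - a i)) * G pt) \<in> multihomogeneous m (d + e)"
  using G
proof induction
  case (mono b)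
  have "(\<lambda>pt. (\<Prod>i<m. fst (pt i) ^ a i * snd (pt i) ^ (d - a i)) * (\<Prod>i<m. fst (pt i) ^ b i * snd (pt i) ^ (e - b i))) =
      (\<lambda>pt :: nat \<Rightarrow> 'a poly \<times> 'a poly. \<Prod>i<m. fst (pt i) ^ (a i + b i) * snd (pt i) ^ (d + e - (a i + b i)))"
  proof
    fix pt :: "nat \<Rightarrow> 'a poly \<times> 'a poly"
    \<comment> \<open>Subtraction of natural numbers is truncated, so the complementary exponents
      add up only because both exponents respect their bounds.\<close>
    have "d + e - (a i + b i) = (d - a i) + (e - b i)" if "i < m" for i
      using a[OF that] mono[OF that] by simp
    then show "(\<Prod>i<m. fst (pt i) ^ a i * snd (pt i) ^ (d - a i)) * (\<Prod>i<m. fst (pt i) ^ b i * snd (pt i) ^ (e - b i)) =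
      (\<Prod>i<m. fst (pt i) ^ (a i + b i) * snd (pt i) ^ (d + e - (a i + b i)))"
      unfolding prod.distrib[symmetric] by (intro prod.cong refl) (simp add: power_add mult_ac)
  qed
  moreover have "a i + b i \<le> d + e" if "i < m" for i
    using a[OF that] mono[OF that] by simp
  ultimately show ?case using multihomogeneous.mono[of m "\<lambda>i. a i + b i" "d + e"] by simp
next
  case zero
  then show ?case by (simp add: multihomogeneous.zero)
next
  case (add F G)
  then show ?case by (simp add: distrib_left multihomogeneous.add)
next
  case (smult F c)
  then show ?case using multihomogeneous.smult[OF smult.IH, of c] by simp
qed

lemma multihomogeneous_mult:
  assumes F: "F \<in> multihomogeneous m d" and G: "G \<in> multihomogeneous m e"
  shows "(\<lambda>pt. F pt * G pt) \<in> multihomogeneous m (d + e)"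
  using F
proof induction
  case (mono a)
  then show ?case by (intro multihomogeneous_mono_mult G)
next
  case zero
  then show ?case by (simp add: multihomogeneous.zero)
next
  case (add F G)
  then show ?case by (simp add: distrib_right multihomogeneous.add)
next
  case (smult F c)
  then show ?case using multihomogeneous.smult[OF smult.IH, of c] by simp
qed

lemma multihomogeneous_prod:
  assumes "\<And>j. j < l \<Longrightarrow> F j \<in> multihomogeneous m 1"
  shows "(\<lambda>pt. \<Prod>j<l. F j pt) \<in> multihomogeneous m l"
  using assms
proof (induction l)
  case 0
  then show ?case using multihomogeneous.mono[of m "\<lambda>_. 0" 0] by simp
next
  case (Suc l)
  then show ?case using multihomogeneous_mult[of "\<lambda>pt. \<Prod>j<l. F j pt" m l "F l" 1] by simp
qed


definition kronecker_point :: "nat \<Rightarrow> nat \<Rightarrow> 'k::field poly \<times> 'k poly" where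
  "kronecker_point N i = (monom 1 (N ^ i), 1)"

section \<open>Symmetric tensors as symmetric functions\<close>

text \<open>An abstract copy of the binary forms of degree d: \<open>u a\<close> plays the monomial
  with exponents a and d - a, and \<open>ev p\<close> is evaluation at p. It is used for E with d =
  1 and for the l-th symmetric power of E with d = l. The bound \<open>d < N\<close> makes exponents
  digits in base N; \<open>2 \<le> N\<close> makes the weights increase strictly even when d =
  0.\<close>

locale sym_model = tensor V m for V :: "('k::field, 'v, 'm) module_scheme" and m :: nat +
  fixes d N :: nat and u :: "nat \<Rightarrow> 'v" and ev :: "'k poly \<times> 'k poly \<Rightarrow> 'v \<Rightarrow> 'k poly"
  assumes u_closed: "a \<le> d \<Longrightarrow> u a \<in> carrier V"
    and u_gen: "carrier V \<subseteq> lspan V (u ` {..d})"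
    and ev_linfun: "linfun V (ev p)"
    and ev_u: "a \<le> d \<Longrightarrow> ev p (u a) = fst p ^ a * snd p ^ (d - a)"
    and N: "d < N" "2 \<le> N"
begin

text \<open>The points \<open>pt\<close> stay arbitrary, since permutations and group elements carry
  the Kronecker point elsewhere.\<close>

definition "\<Psi> pt w = tensor_eval (\<lambda>i. ev (pt i)) w"
abbreviation pt0 :: "nat \<Rightarrow> 'k poly \<times> 'k poly" where "pt0 \<equiv> kronecker_point N"
definition "exponents = {a. length a = m \<and> set a \<subseteq> {..d}}"

lemma exponents_finite: "finite exponents"
  using finite_lists_length_eq[of "{..d}" m] by (simp add: exponents_def conj_commute)

lemma \<Psi>_linfun: "linfun T (\<Psi> pt)"
  using tensor_eval_linfun[of "\<lambda>i. ev (pt i)"] ev_linfun by (simp add: \<Psi>_def[abs_def])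

lemma exponents_tuples: "a \<in> exponents \<Longrightarrow> map u a \<in> tuples V m"
  using u_closed by (auto simp: exponents_def tuples_def)

lemma \<Psi>_pure:
  "a \<in> exponents \<Longrightarrow> \<Psi> pt (pure_tensor V (map u a)) = (\<Prod>i<m. fst (pt i) ^ (a ! i) * snd (pt i) ^ (d - a ! i))"
  unfolding \<Psi>_def using exponents_tuples[of a]
  by (subst tensor_eval_pure) (auto simp: ev_linfun exponents_def ev_u subset_iff intro!: prod.cong)

lemma \<kappa>_pure: "a \<in> exponents \<Longrightarrow> \<Psi> pt0 (pure_tensor V (map u a)) = monom 1 (base_value N a)"
  by (simp add: \<Psi>_pure kronecker_point_def monom_power prod_monom base_value_def exponents_def mult.commute)

lemma pure_exponents_sub: "(\<lambda>a. pure_tensor V (map u a)) ` exponents \<subseteq> carrier T"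
  using pure_tensor_closed exponents_tuples by auto

lemma T_gen: "carrier T \<subseteq> lspan T ((\<lambda>a. pure_tensor V (map u a)) ` exponents)"
proof -
  have "xs \<in> map u ` exponents" if xs: "length xs = m" "set xs \<subseteq> u ` {..d}" for xs
  proof -
    have "inv_into {..d} u x \<in> {..d} \<and> u (inv_into {..d} u x) = x" if "x \<in> set xs" for x
      using that xs(2) inv_into_into[of x u "{..d}"] f_inv_into_f[of x u "{..d}"] by auto
    then have "map (inv_into {..d} u) xs \<in> exponents" "map u (map (inv_into {..d} u) xs) = xs"
      using xs(1) by (auto simp: exponents_def intro!: map_idI)
    then show ?thesis by (metis imageI)
  qed
  then have "pure_tensor V ` {xs. length xs = m \<and> set xs \<subseteq> u ` {..d}} \<subseteq> (\<lambda>a. pure_tensor V (map u a)) ` exponents"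
    by (auto simp: image_image[symmetric])
  then have *: "pure_tensor V ` {xs. length xs = m \<and> set xs \<subseteq> u ` {..d}} \<subseteq> lspan T ((\<lambda>a. pure_tensor V (map u a)) ` exponents)"
    by (rule subset_trans) (rule subsetI, rule lspan.base)
  have "u ` {..d} \<subseteq> carrier V" using u_closed by auto
  note sub = T_lspan_gen[OF this u_gen]
  show ?thesis by (rule subsetI, rule lspan_trans[OF _ *], rule subsetD[OF sub])
qed

lemma exponents_base_value_inj: "a \<in> exponents \<Longrightarrow> a' \<in> exponents \<Longrightarrow> base_value N a = base_value N a' \<longleftrightarrow> a = a'"
  using base_value_inj[of a a' N] N by (fastforce simp: exponents_def)

text \<open>The generating pure tensors take monomial values with pairwise different exponents, by
  uniqueness of digits, so evaluation at one point already separates tensors.\<close>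

lemma \<kappa>_inj: "w \<in> carrier T \<Longrightarrow> \<Psi> pt0 w = 0 \<Longrightarrow> w = \<zero>\<^bsub>T\<^esub>"
  by (rule linfun_inj_by_degree[OF T_kspace exponents_finite pure_exponents_sub _ \<Psi>_linfun])
    (use T_gen in \<open>auto simp: \<kappa>_pure monom_eq_0_iff degree_monom_eq exponents_base_value_inj inj_on_def\<close>)

lemma \<kappa>_eq:
  assumes "v \<in> carrier T" "w \<in> carrier T" "\<Psi> pt0 v = \<Psi> pt0 w"
  shows "v = w"
proof -
  have "v \<ominus>\<^bsub>T\<^esub> w = \<zero>\<^bsub>T\<^esub>"
    using assms by (intro \<kappa>_inj) (auto simp: linfun_minus[OF T_kspace \<Psi>_linfun])
  then show ?thesis using T.minus_add_cancel[OF assms(1,2)] assms(2) by simp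
qed

lemma \<Psi>_pperm:
  assumes \<sigma>: "\<sigma> permutes {..<m}" and w: "w \<in> carrier T"
  shows "\<Psi> (pt \<circ> \<sigma>) (pperm \<sigma> w) = \<Psi> pt w"
  using tensor_eval_pperm[OF \<sigma>, of "\<lambda>i. ev (pt i)" w] w ev_linfun by (simp add: \<Psi>_def)

lemma multihomogeneous_realised: "H \<in> multihomogeneous m d \<Longrightarrow> \<exists>w\<in>carrier T. \<forall>pt. \<Psi> pt w = H pt"
proof (induction rule: multihomogeneous.induct)
  case (mono a)
  then have a: "map a [0..<m] \<in> exponents" by (auto simp: exponents_def)
  then show ?case
    using pure_exponents_sub by (intro bexI[of _ "pure_tensor V (map u (map a [0..<m]))"] allI) (auto simp: \<Psi>_pure simp del: map_map)
next
  case zero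
  then show ?case by (intro bexI[of _ "\<zero>\<^bsub>T\<^esub>"]) (auto simp: linfun_zero[OF T_kspace \<Psi>_linfun])
next
  case (add H G)
  then obtain v w where "v \<in> carrier T" "\<forall>pt. \<Psi> pt v = H pt" "w \<in> carrier T" "\<forall>pt. \<Psi> pt w = G pt" by blast
  then show ?case by (intro bexI[of _ "v \<oplus>\<^bsub>T\<^esub> w"]) (auto simp: linfunD[OF \<Psi>_linfun])
next
  case (smult H c)
  then obtain v where "v \<in> carrier T" "\<forall>pt. \<Psi> pt v = H pt" by blast
  then show ?case by (intro bexI[of _ "c \<odot>\<^bsub>T\<^esub> v"]) (auto simp: linfunD[OF \<Psi>_linfun])
qed

text \<open>Any tensor realising H is automatically invariant: its place permutations take the same
  value at the Kronecker point, where tensors are separated.\<close>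

lemma sym_homs_realised:
  assumes H: "H \<in> multihomogeneous m d" and sym: "\<And>\<sigma> pt. \<sigma> permutes {..<m} \<Longrightarrow> H (pt \<circ> \<sigma>) = H pt"
  shows "\<exists>w\<in>inv_tensors. \<forall>pt. \<Psi> pt w = H pt"
proof -
  obtain w where w: "w \<in> carrier T" "\<And>pt. \<Psi> pt w = H pt" using multihomogeneous_realised[OF H] by blast
  have "pperm \<sigma> w = w" if \<sigma>: "\<sigma> permutes {..<m}" for \<sigma>
  proof (rule \<kappa>_eq)
    show "pperm \<sigma> w \<in> carrier T" using HomD(1)[OF pperm_Hom[OF \<sigma>] w(1)] .
    \<comment> \<open>Chosen so that composing with \<sigma> gives back \<open>pt0\<close>, the
      point at which \<open>\<kappa>_eq\<close> applies.\<close>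
    let ?pt = "pt0 \<circ> inv_into UNIV \<sigma>"
    have pt: "?pt \<circ> \<sigma> = pt0" using permutes_inverses[OF \<sigma>] by (auto simp: fun_eq_iff)
    have "\<Psi> pt0 (pperm \<sigma> w) = H ?pt" using \<Psi>_pperm[OF \<sigma> w(1), of ?pt] w(2) by (simp add: pt)
    also have "\<dots> = H pt0" using sym[OF \<sigma>, of ?pt] by (simp add: pt)
    finally show "\<Psi> pt0 (pperm \<sigma> w) = \<Psi> pt0 w" by (simp add: w(2))
  qed (rule w)
  then show ?thesis using w by (auto simp: inv_tensors_def)
qed

text \<open>Swapping two entries of an exponent that are out of order increases the degree at the Kronecker
  point, while a symmetric tensor is unchanged; so its leading exponent is sorted.\<close>

lemma leading_exponent:
  assumes w: "w \<in> inv_tensors" and nz: "\<Psi> pt0 w \<noteq> 0"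
  shows "\<exists>a\<in>exponents. sorted a \<and> degree (\<Psi> pt0 w) = base_value N a"
proof -
  let ?D = "degree (\<Psi> pt0 w)"
  have wT: "w \<in> carrier T" using w inv_tensors_sub by auto
  obtain c where c: "\<And>L. linfun T L \<Longrightarrow> L w = (\<Sum>a\<in>exponents. Polynomial.smult (c a) (L (pure_tensor V (map u a))))"
    using lspan_coords[OF T_kspace exponents_finite pure_exponents_sub subsetD[OF T_gen wT]] by blast
  have "\<Psi> pt0 w = (\<Sum>a\<in>exponents. Polynomial.smult (c a) (monom 1 (base_value N a)))"
    unfolding c[OF \<Psi>_linfun] by (intro sum.cong) (auto simp: \<kappa>_pure)
  then have "coeff (\<Psi> pt0 w) ?D = (\<Sum>a\<in>exponents. if base_value N a = ?D then c a else 0)"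
    by (simp add: coeff_sum if_distrib cong: if_cong)
  moreover have "coeff (\<Psi> pt0 w) ?D \<noteq> 0" using nz by simp
  ultimately have "(\<Sum>a\<in>exponents. if base_value N a = ?D then c a else 0) \<noteq> 0" by simp
  then obtain a where "a \<in> exponents" "(if base_value N a = ?D then c a else 0) \<noteq> 0"
    by (rule sum.not_neutral_contains_not_neutral)
  then have a: "a \<in> exponents" "c a \<noteq> 0" "base_value N a = ?D" by (auto split: if_splits)
  have len: "length a = m" using a by (simp add: exponents_def)
  have "sorted a"
  proof (rule ccontr)
    assume "\<not> sorted a"
    then obtain i j where ij: "i < j" "j < m" "a ! j < a ! i"
      unfolding sorted_iff_nth_mono_less len by (meson not_le)
    let ?\<sigma> = "Transposition.transpose i j"
    have \<sigma>: "?\<sigma> permutes {..<m}" using ij by (intro permutes_swap_id) auto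
    have perm_A: "permute_list ?\<sigma> b \<in> exponents" if "b \<in> exponents" for b
      using that \<sigma> by (auto simp: exponents_def)
    have perm_inj: "b = b'" if "b \<in> exponents" "b' \<in> exponents" "permute_list ?\<sigma> b = permute_list ?\<sigma> b'" for b b'
    proof -
      have "length b = m" "length b' = m" using that by (auto simp: exponents_def)
      have "b ! k = b' ! k" if k: "k < m" for k
      proof -
        have "?\<sigma> k < m" using permutes_in_image[OF \<sigma>, of k] k by simp
        then have "permute_list ?\<sigma> b ! ?\<sigma> k = b ! k" "permute_list ?\<sigma> b' ! ?\<sigma> k = b' ! k"
          using \<open>length b = m\<close> \<open>length b' = m\<close> \<sigma> by (simp_all add: permute_list_nth)
        then show ?thesis using \<open>permute_list ?\<sigma> b = permute_list ?\<sigma> b'\<close> by simp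
      qed
      then show ?thesis using \<open>length b = m\<close> \<open>length b' = m\<close> by (intro nth_equalityI) auto
    qed
    have "\<Psi> pt0 w = \<Psi> pt0 (pperm ?\<sigma> w)" using w \<sigma> by (simp add: inv_tensors_def)
    \<comment> \<open>The coordinates c of w serve every linear functional, in particular evaluation
      after the swap.\<close>
    also have "\<dots> = (\<Sum>b\<in>exponents. Polynomial.smult (c b) (\<Psi> pt0 (pperm ?\<sigma> (pure_tensor V (map u b)))))"
      by (rule c[OF linfun_Hom[OF \<Psi>_linfun pperm_Hom[OF \<sigma>]]])
    also have "\<dots> = (\<Sum>b\<in>exponents. Polynomial.smult (c b) (monom 1 (base_value N (permute_list ?\<sigma> b))))"
    proof (intro sum.cong refl)
      fix b assume b: "b \<in> exponents"
      have "permute_list ?\<sigma> (map u b) = map u (permute_list ?\<sigma> b)"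
        using \<sigma> b by (intro permute_list_map) (simp add: exponents_def)
      then show "Polynomial.smult (c b) (\<Psi> pt0 (pperm ?\<sigma> (pure_tensor V (map u b)))) =
          Polynomial.smult (c b) (monom 1 (base_value N (permute_list ?\<sigma> b)))"
        using b by (simp add: pperm_pure[OF \<sigma> exponents_tuples] \<kappa>_pure perm_A)
    qed
    finally have "coeff (\<Psi> pt0 w) (base_value N (permute_list ?\<sigma> a)) =
        (\<Sum>b\<in>exponents. if base_value N (permute_list ?\<sigma> b) = base_value N (permute_list ?\<sigma> a) then c b else 0)"
      by (simp add: coeff_sum if_distrib cong: if_cong)
    also have "\<dots> = (\<Sum>b\<in>exponents. if b = a then c b else 0)"
      using a perm_A perm_inj by (intro sum.cong) (auto simp: exponents_base_value_inj)
    also have "\<dots> = c a" using a exponents_finite by simp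
    \<comment> \<open>The coefficient at the swapped exponent is \<open>c a\<close>, which is
      nonzero, so the degree is at least that exponent; but the swap made it larger than
      \<open>?D\<close>.\<close>
    finally have "base_value N (permute_list ?\<sigma> a) \<le> ?D" using a(2) by (intro le_degree) simp
    then show False using base_value_swap[of i j a N] ij len N a(3) by simp
  qed
  then show ?thesis using a by auto
qed

text \<open>Leading-term elimination. Sorted exponents are the only possible leading ones, and Z has
  an element for each; subtracting a multiple of it lowers the degree at the Kronecker point, and
  \<open>\<kappa>_inj\<close> ends the descent.\<close>

lemma inv_tensors_gen:
  assumes Z: "Z \<subseteq> inv_tensors"
    and lead: "\<And>a. a \<in> exponents \<Longrightarrow> sorted a \<Longrightarrow> \<exists>z\<in>Z. \<Psi> pt0 z \<noteq> 0 \<and> degree (\<Psi> pt0 z) = base_value N a"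
  shows "inv_tensors \<subseteq> lspan Sl Z"
proof -
  interpret Sl: kspace Sl by (rule Sl_kspace)
  \<comment> \<open>The bound is put as vanishing of coefficients rather than on the degree, so that
    n = 0 means the zero polynomial.\<close>
  have "w \<in> inv_tensors \<Longrightarrow> \<forall>k\<ge>n. coeff (\<Psi> pt0 w) k = 0 \<Longrightarrow> w \<in> lspan Sl Z" for n w
  proof (induction n arbitrary: w)
    case 0
    then have "\<Psi> pt0 w = 0" by (simp add: poly_eq_iff)
    then have "w = \<zero>\<^bsub>Sl\<^esub>" using 0 inv_tensors_sub \<kappa>_inj[of w] by auto
    then show ?case using lspan.zero[of Sl Z] by simp
  next
    case (Suc n)
    show ?case
    proof (cases "coeff (\<Psi> pt0 w) n = 0")
      case True
      then show ?thesis using Suc by (metis le_eq_less_or_eq less_eq_Suc_le)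
    next
      case False
      have deg: "degree (\<Psi> pt0 w) = n"
        using Suc.prems(2) False by (intro antisym degree_le le_degree) auto
      have "\<Psi> pt0 w \<noteq> 0" using False by auto
      then obtain a where "a \<in> exponents" "sorted a" "degree (\<Psi> pt0 w) = base_value N a"
        using leading_exponent[OF Suc.prems(1)] by blast
      then obtain z where z: "z \<in> Z" "\<Psi> pt0 z \<noteq> 0" "degree (\<Psi> pt0 z) = n" using lead deg by metis
      define c where "c = coeff (\<Psi> pt0 w) n / coeff (\<Psi> pt0 z) n"
      have zn: "coeff (\<Psi> pt0 z) n \<noteq> 0" using z by auto
      have zi: "z \<in> inv_tensors" using z Z by auto
      let ?w = "w \<oplus>\<^bsub>T\<^esub> (- c) \<odot>\<^bsub>T\<^esub> z"
      have wi: "?w \<in> inv_tensors"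
        using Sl.add_closed[of w "(- c) \<odot>\<^bsub>T\<^esub> z"] Sl.scale_closed[of z "- c"] Suc.prems zi by simp
      have w_eq: "\<Psi> pt0 ?w = \<Psi> pt0 w + Polynomial.smult (- c) (\<Psi> pt0 z)"
        using Suc.prems zi inv_tensors_sub by (simp add: linfunD[OF \<Psi>_linfun] subset_iff)
      have "coeff (\<Psi> pt0 ?w) k = 0" if k: "n \<le> k" for k
      proof (cases "k = n")
        case True
        then show ?thesis unfolding w_eq using zn by (simp add: c_def)
      next
        case False
        then show ?thesis unfolding w_eq using k Suc.prems(2) z(3) by (simp add: coeff_eq_0)
      qed
      then have "\<forall>k\<ge>n. coeff (\<Psi> pt0 ?w) k = 0" by blast
      from Suc.IH[OF wi this] have "?w \<in> lspan Sl Z" .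
      from lspan.add[OF this lspan.smult[OF lspan.base[OF z(1)], of Sl c]]
      have "?w \<oplus>\<^bsub>T\<^esub> c \<odot>\<^bsub>T\<^esub> z \<in> lspan Sl Z" by simp
      moreover have "?w \<oplus>\<^bsub>T\<^esub> c \<odot>\<^bsub>T\<^esub> z = w"
        using Suc.prems zi inv_tensors_sub T.scale_add_left[of z "- c" c, symmetric]
        by (simp add: T.add_assoc subset_iff)
      ultimately show ?thesis by simp
    qed
  qed
  then show ?thesis by (meson coeff_eq_0 le_less_trans lessI subsetI order_less_le_trans Suc_le_eq)
qed

end

section \<open>Elementary symmetric functions\<close>

definition top_subsets :: "nat \<Rightarrow> nat \<Rightarrow> nat set set" where
  "top_subsets m r = {S. S \<subseteq> {..<m} \<and> card S = m - r}"

text \<open>The elementary symmetric function of degree \<open>m - r\<close> in the \<open>x\<^sub>i\<close>. With this indexing its leading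
  set is \<open>{r..<m}\<close>, and the weights \<open>N ^ i\<close> increase with \<open>i\<close>.\<close>

definition esym :: "nat \<Rightarrow> nat \<Rightarrow> (nat \<Rightarrow> 'k::field poly \<times> 'k poly) \<Rightarrow> 'k poly" where
  "esym m r pt = (\<Sum>S\<in>top_subsets m r. \<Prod>i<m. if i \<in> S then fst (pt i) else snd (pt i))"

lemma finite_top_subsets: "finite (top_subsets m r)"
  unfolding top_subsets_def by (rule finite_subset[of _ "Pow {..<m}"]) auto

lemma esym_multihomogeneous: "(esym m r :: (nat \<Rightarrow> 'k::field poly \<times> 'k poly) \<Rightarrow> 'k poly) \<in> multihomogeneous m 1"
proof -
  have "(\<lambda>pt :: nat \<Rightarrow> 'k poly \<times> 'k poly. \<Prod>i<m. if i \<in> S then fst (pt i) else snd (pt i)) \<in> multihomogeneous m 1" for S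
  proof -
    have "(\<lambda>pt :: nat \<Rightarrow> 'k poly \<times> 'k poly. \<Prod>i<m. if i \<in> S then fst (pt i) else snd (pt i)) =
        (\<lambda>pt. \<Prod>i<m. fst (pt i) ^ (if i \<in> S then 1 else 0) * snd (pt i) ^ (1 - (if i \<in> S then 1 else 0)))"
      by (intro ext prod.cong refl) auto
    also have "\<dots> \<in> multihomogeneous m 1" by (rule multihomogeneous.mono) auto
    finally show ?thesis .
  qed
  then show ?thesis
    unfolding esym_def[abs_def] by (intro multihomogeneous_sum finite_top_subsets)
qed

text \<open>Permuting the points only permutes the index sets of the sum.\<close>

lemma esym_sym:
  assumes \<sigma>: "\<sigma> permutes {..<m}"
  shows "esym m r (pt \<circ> \<sigma>) = esym m r pt"
  unfolding esym_def
proof (rule sum.reindex_bij_witness[where j = "\<lambda>S. \<sigma> ` S" and i = "\<lambda>S. inv_into UNIV \<sigma> ` S"])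
  fix S assume S: "S \<in> top_subsets m r"
  have inj: "inj \<sigma>" using \<sigma> by (rule permutes_inj)
  show "inv_into UNIV \<sigma> ` \<sigma> ` S = S" using inj by (simp add: image_comp)
  show "\<sigma> ` inv_into UNIV \<sigma> ` S = S"
    using permutes_inverses(1)[OF \<sigma>] by (simp add: image_image)
  show "\<sigma> ` S \<in> top_subsets m r"
    using S permutes_in_image[OF \<sigma>] card_image[OF inj_on_subset[OF inj, of S]]
    by (auto simp: top_subsets_def)
  show "inv_into UNIV \<sigma> ` S \<in> top_subsets m r"
    using S permutes_in_image[OF permutes_inv[OF \<sigma>]]
      card_image[OF inj_on_subset[OF permutes_inj[OF permutes_inv[OF \<sigma>]], of S]]
    by (auto simp: top_subsets_def)
  have "(\<Prod>i<m. if i \<in> \<sigma> ` S then fst (pt i) else snd (pt i)) =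
      (\<Prod>i<m. if \<sigma> i \<in> \<sigma> ` S then fst (pt (\<sigma> i)) else snd (pt (\<sigma> i)))"
    using prod.permute[OF \<sigma>, of "\<lambda>i. if i \<in> \<sigma> ` S then fst (pt i) else snd (pt i)"] by (simp add: o_def)
  then show "(\<Prod>i<m. if i \<in> \<sigma> ` S then fst (pt i) else snd (pt i)) =
      (\<Prod>i<m. if i \<in> S then fst ((pt \<circ> \<sigma>) i) else snd ((pt \<circ> \<sigma>) i))"
    using inj unfolding comp_def by (simp add: inj_image_mem_iff)
qed

lemma sum_powers_less:
  fixes N :: nat
  assumes "2 \<le> N"
  shows "(\<Sum>i<m. N ^ i) < N ^ m"
proof (induction m)
  case (Suc m)
  have "(\<Sum>i<Suc m. N ^ i) < 2 * N ^ m" using Suc by simp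
  also have "\<dots> \<le> N ^ Suc m" using assms by simp
  finally show ?case .
qed simp

text \<open>The last m - r indices form the heaviest set of their size. By induction on m: a shared
  top index is removed from both sets, and a set that misses the top index weighs less than its
  single weight, since the lower powers of N sum to less than the next one.\<close>

lemma subset_weight_less:
  fixes N :: nat
  assumes N: "2 \<le> N" and "S \<subseteq> {..<m}" "card S = m - r" "r \<le> m" "S \<noteq> {r..<m}"
  shows "(\<Sum>i\<in>S. N ^ i) < (\<Sum>i=r..<m. N ^ i)"
  using assms(2-)
proof (induction m arbitrary: S)
  case (Suc m)
  have fin: "finite S" using Suc.prems(1) finite_subset by blast
  show ?case
  proof (cases "m \<in> S")
    case True
    have r: "r \<le> m" using True Suc.prems(2,3) fin by (cases "r = Suc m") auto
    have "S = insert m (S - {m})" "{r..<Suc m} = insert m {r..<m}" using True r by auto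
    then have "S - {m} \<noteq> {r..<m}" using Suc.prems(4) by metis
    moreover have "S - {m} \<subseteq> {..<m}" using Suc.prems(1) by (auto simp: less_Suc_eq)
    moreover have "card (S - {m}) = m - r" using Suc.prems(2) True by simp
    ultimately have "(\<Sum>i\<in>S - {m}. N ^ i) < (\<Sum>i=r..<m. N ^ i)" using Suc.IH r by blast
    then show ?thesis
      using sum.remove[OF fin True, of "\<lambda>i. N ^ i"] r by simp
  next
    case False
    then have S: "S \<subseteq> {..<m}" using Suc.prems(1) by (auto simp: less_Suc_eq)
    then have "card S \<le> m" using card_mono[of "{..<m}" S] by simp
    \<comment> \<open>\<open>r = Suc m\<close> would force S to be empty, hence equal to
      \<open>{r..<Suc m}\<close>.\<close>
    have r: "r \<le> m" using Suc.prems fin by (cases "r = Suc m") auto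
    have "(\<Sum>i\<in>S. N ^ i) \<le> (\<Sum>i<m. N ^ i)" using S by (intro sum_mono2) auto
    also have "\<dots> < N ^ m" by (rule sum_powers_less[OF N])
    also have "\<dots> \<le> (\<Sum>i=r..<Suc m. N ^ i)" using r by simp
    finally show ?thesis .
  qed
qed simp

text \<open>Every term other than that of \<open>{r..<m}\<close> has smaller degree, so the top
  coefficient is 1 whatever the characteristic.\<close>

lemma esym_kronecker:
  assumes N: "2 \<le> N" and r: "r \<le> m"
  shows "esym m r (kronecker_point N) \<noteq> (0 :: 'k::field poly)"
    and "degree (esym m r (kronecker_point N) :: 'k poly) = (\<Sum>i=r..<m. N ^ i)"
proof -
  let ?D = "\<Sum>i=r..<m. N ^ i" and ?w = "\<lambda>S. \<Sum>i\<in>S. N ^ i"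
  let ?e = "esym m r (kronecker_point N) :: 'k poly"
  have e: "?e = (\<Sum>S\<in>top_subsets m r. monom 1 (?w S))"
    unfolding esym_def
  proof (intro sum.cong refl)
    fix S assume S: "S \<in> top_subsets m r"
    have "(\<Prod>i<m. if i \<in> S then fst (kronecker_point N i) else snd (kronecker_point N i :: 'k poly \<times> _)) =
        (\<Prod>i\<in>S. monom 1 (N ^ i))"
      using S by (intro prod.mono_neutral_cong_right) (auto simp: kronecker_point_def top_subsets_def)
    then show "(\<Prod>i<m. if i \<in> S then fst (kronecker_point N i) else snd (kronecker_point N i :: 'k poly \<times> _)) =
        monom 1 (?w S)" by (simp add: prod_monom)
  qed
  have top: "{r..<m} \<in> top_subsets m r" using r by (auto simp: top_subsets_def)
  have less: "?w S < ?D" if "S \<in> top_subsets m r" "S \<noteq> {r..<m}" for S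
    using subset_weight_less[OF N _ _ r, of S] that by (auto simp: top_subsets_def)
  have "coeff ?e ?D = (\<Sum>S\<in>top_subsets m r. if S = {r..<m} then 1 else 0)"
    unfolding e coeff_sum using less by (intro sum.cong) (auto dest: less_imp_neq)
  then have c: "coeff ?e ?D = 1" using top finite_top_subsets by simp
  then show "?e \<noteq> 0" by auto
  have "degree ?e \<le> ?D"
    unfolding e
  proof (rule degree_sum_le[OF finite_top_subsets])
    fix S assume "S \<in> top_subsets m r"
    then show "degree (monom (1 :: 'k) (?w S)) \<le> ?D"
      using less[of S] by (cases "S = {r..<m}") (auto simp: degree_monom_eq)
  qed
  moreover have "?D \<le> degree ?e" using c by (intro le_degree) simp
  ultimately show "degree ?e = ?D" by simp
qed

text \<open>The conjugate partition: the leading exponent of the product of the \<open>esym m k\<close> with \<open>k\<close> in \<open>ks\<close>.\<close>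

definition dual_parts :: "nat \<Rightarrow> nat list \<Rightarrow> nat list" where
  "dual_parts m ks = map (\<lambda>i. card {j. j < length ks \<and> ks ! j \<le> i}) [0..<m]"

definition esym_prod :: "nat \<Rightarrow> nat list \<Rightarrow> (nat \<Rightarrow> 'k::field poly \<times> 'k poly) \<Rightarrow> 'k poly" where
  "esym_prod m ks pt = (\<Prod>j<length ks. esym m (ks ! j) pt)"

lemma esym_prod_multihomogeneous: "esym_prod m ks \<in> multihomogeneous m (length ks)"
  unfolding esym_prod_def[abs_def] by (intro multihomogeneous_prod esym_multihomogeneous)

lemma esym_prod_sym: "\<sigma> permutes {..<m} \<Longrightarrow> esym_prod m ks (pt \<circ> \<sigma>) = esym_prod m ks pt"
  by (simp add: esym_prod_def esym_sym)

text \<open>Degrees add over the factors. Exchanging the two summations, the weight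
  \<open>N ^ i\<close> is counted once for each factor with \<open>ks ! j \<le> i\<close>, which is
  the i-th entry of \<open>dual_parts m ks\<close>.\<close>

lemma esym_prod_kronecker:
  assumes N: "2 \<le> N" and ks: "set ks \<subseteq> {..m}"
  shows "esym_prod m ks (kronecker_point N) \<noteq> (0 :: 'k::field poly)"
    and "degree (esym_prod m ks (kronecker_point N) :: 'k poly) = base_value N (dual_parts m ks)"
proof -
  have le: "ks ! j \<le> m" if "j < length ks" for j using ks that nth_mem by blast
  then have nz: "\<forall>j\<in>{..<length ks}. esym m (ks ! j) (kronecker_point N) \<noteq> (0 :: 'k poly)"
    using esym_kronecker(1)[OF N] by auto
  then show "esym_prod m ks (kronecker_point N) \<noteq> (0 :: 'k poly)"
    by (simp add: esym_prod_def)
  have "degree (esym_prod m ks (kronecker_point N) :: 'k poly) =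
      (\<Sum>j<length ks. degree (esym m (ks ! j) (kronecker_point N) :: 'k poly))"
    unfolding esym_prod_def using nz by (intro degree_prod_eq_sum_degree) auto
  also have "\<dots> = (\<Sum>j<length ks. \<Sum>i=ks ! j..<m. N ^ i)"
    using le by (intro sum.cong refl esym_kronecker(2)[OF N]) auto
  also have "\<dots> = (\<Sum>j<length ks. \<Sum>i<m. if ks ! j \<le> i then N ^ i else 0)"
    by (intro sum.cong refl sum.mono_neutral_cong_left) auto
  also have "\<dots> = (\<Sum>i<m. \<Sum>j<length ks. if ks ! j \<le> i then N ^ i else 0)"
    by (rule sum.swap)
  also have "\<dots> = (\<Sum>i<m. card {j. j < length ks \<and> ks ! j \<le> i} * N ^ i)"
  proof (intro sum.cong refl)
    fix i
    have "(\<Sum>j<length ks. if ks ! j \<le> i then N ^ i else 0) = (\<Sum>j | j < length ks \<and> ks ! j \<le> i. N ^ i)"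
      by (intro sum.mono_neutral_cong_right) auto
    then show "(\<Sum>j<length ks. if ks ! j \<le> i then N ^ i else 0) = card {j. j < length ks \<and> ks ! j \<le> i} * N ^ i"
      by simp
  qed
  also have "\<dots> = base_value N (dual_parts m ks)" by (simp add: base_value_def dual_parts_def)
  finally show "degree (esym_prod m ks (kronecker_point N) :: 'k poly) = base_value N (dual_parts m ks)" .
qed

section \<open>Conjugation of partitions\<close>

lemma card_le_length: "card {j. j < (l :: nat) \<and> P j} \<le> l"
  using card_mono[of "{..<l}" "{j. j < l \<and> P j}"] by auto

lemma dual_parts_entries: "set (dual_parts m ks) \<subseteq> {..length ks}"
  by (auto simp: dual_parts_def card_le_length)

lemma length_dual_parts [simp]: "length (dual_parts m ks) = m"
  by (simp add: dual_parts_def)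

text \<open>The entry of the conjugate at position \<open>ks ! j\<close> detects the difference:
  sortedness puts at least j + 1 entries of \<open>ks\<close> at or below that value, but at most j
  entries of \<open>ks'\<close>.\<close>

lemma dual_parts_inj_aux:
  assumes "sorted ks" "sorted ks'" "length ks = length ks'" "set ks \<subseteq> {..m}" "set ks' \<subseteq> {..m}"
    and eq: "dual_parts m ks = dual_parts m ks'" and j: "j < length ks"
  shows "\<not> ks ! j < ks' ! j"
proof
  assume less: "ks ! j < ks' ! j"
  let ?i = "ks ! j"
  have "ks' ! j \<in> set ks'" using assms(3) j by simp
  then have "ks' ! j \<le> m" using assms(5) by blast
  \<comment> \<open>Entries may equal m, while \<open>dual_parts\<close> has positions below m only;
    the smaller of the two entries is a valid position.\<close>
  then have i: "?i < m" using less by simp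
  have "{..j} \<subseteq> {j'. j' < length ks \<and> ks ! j' \<le> ?i}"
    using sorted_nth_mono[OF assms(1)] j by auto
  from card_mono[OF _ this] have "j < card {j'. j' < length ks \<and> ks ! j' \<le> ?i}" by simp
  moreover have "{j'. j' < length ks' \<and> ks' ! j' \<le> ?i} \<subseteq> {..<j}"
  proof (intro subsetI; rule ccontr)
    fix j' assume j': "j' \<in> {j'. j' < length ks' \<and> ks' ! j' \<le> ?i}" "j' \<notin> {..<j}"
    then have "ks' ! j \<le> ks' ! j'" using sorted_nth_mono[OF assms(2), of j j'] by auto
    then show False using j' less by auto
  qed
  from card_mono[OF _ this] have "card {j'. j' < length ks' \<and> ks' ! j' \<le> ?i} \<le> j" by simp
  moreover have "dual_parts m ks ! ?i = dual_parts m ks' ! ?i" by (simp add: eq)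
  ultimately show False using i by (simp add: dual_parts_def)
qed

lemma dual_parts_inj:
  assumes "sorted ks" "sorted ks'" "length ks = length ks'" "set ks \<subseteq> {..m}" "set ks' \<subseteq> {..m}"
    "dual_parts m ks = dual_parts m ks'"
  shows "ks = ks'"
proof (rule nth_equalityI[OF assms(3)])
  fix j assume j: "j < length ks"
  show "ks ! j = ks' ! j"
    using dual_parts_inj_aux[OF assms j] dual_parts_inj_aux[OF assms(2,1) assms(3)[symmetric] assms(5,4) assms(6)[symmetric], of j]
      j assms(3) by (metis linorder_neqE_nat)
qed

text \<open>Conjugation undoes itself: the witness is the conjugate of a, taken over the l possible
  values j.\<close>

lemma dual_parts_surj:
  assumes a: "sorted a" "length a = m" "set a \<subseteq> {..l}"
  shows "\<exists>ks. length ks = l \<and> set ks \<subseteq> {..m} \<and> dual_parts m ks = a"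
proof (intro exI[of _ "map (\<lambda>j. card {i. i < m \<and> a ! i \<le> j}) [0..<l]"] conjI)
  let ?ks = "map (\<lambda>j. card {i. i < m \<and> a ! i \<le> j}) [0..<l]"
  show "set ?ks \<subseteq> {..m}" by (auto simp: card_le_length)
  show "dual_parts m ?ks = a"
  proof (rule nth_equalityI)
    fix i assume "i < length (dual_parts m ?ks)"
    then have i: "i < m" by simp
    \<comment> \<open>As a is sorted, the indices with entry at most j form an initial segment, so
      comparing its length with i amounts to comparing j with \<open>a ! i\<close>.\<close>
    have iff: "card {i'. i' < m \<and> a ! i' \<le> j} \<le> i \<longleftrightarrow> j < a ! i" for j
    proof
      assume j: "j < a ! i"
      have "{i'. i' < m \<and> a ! i' \<le> j} \<subseteq> {..<i}"
      proof (intro subsetI; rule ccontr)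
        fix i' assume i': "i' \<in> {i'. i' < m \<and> a ! i' \<le> j}" "i' \<notin> {..<i}"
        then have "a ! i \<le> a ! i'" using sorted_nth_mono[OF a(1), of i i'] a(2) by auto
        then show False using i' j by auto
      qed
      from card_mono[OF _ this] show "card {i'. i' < m \<and> a ! i' \<le> j} \<le> i" by simp
    next
      assume card: "card {i'. i' < m \<and> a ! i' \<le> j} \<le> i"
      show "j < a ! i"
      proof (rule ccontr)
        assume "\<not> j < a ! i"
        then have "{..i} \<subseteq> {i'. i' < m \<and> a ! i' \<le> j}"
          using i a(2) sorted_nth_mono[OF a(1), of _ i] by fastforce
        from card_mono[OF _ this] show False using card by simp
      qed
    qed
    have "a ! i \<in> set a" using a(2) i by simp
    then have ai: "a ! i \<le> l" using a(3) by blast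
    have "dual_parts m ?ks ! i = card {j. j < l \<and> card {i'. i' < m \<and> a ! i' \<le> j} \<le> i}"
      using i by (auto simp: dual_parts_def intro!: arg_cong[of _ _ card])
    also have "{j. j < l \<and> card {i'. i' < m \<and> a ! i' \<le> j} \<le> i} = {..<a ! i}"
      using ai by (auto simp: iff)
    finally show "dual_parts m ?ks ! i = a ! i" by simp
  qed (simp add: a)
qed simp

section \<open>The isomorphism\<close>

text \<open>Having the same values for all p is compatible with sums and scalar multiples, so
  partners extend from A to its span as a relation, even though the elements of A may satisfy linear
  relations.\<close>

lemma linfun_rel_total:
  assumes X: "kspace X" and Y: "kspace Y" and \<Phi>: "\<And>p. linfun X (\<Phi> p)" and \<Psi>: "\<And>p. linfun Y (\<Psi> p)"
    and A: "A \<subseteq> carrier X" and gen: "carrier X \<subseteq> lspan X A"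
    and rel: "\<And>x. x \<in> A \<Longrightarrow> \<exists>y\<in>carrier Y. \<forall>p. \<Phi> p x = \<Psi> p y" and x: "x \<in> carrier X"
  shows "\<exists>y\<in>carrier Y. \<forall>p. \<Phi> p x = \<Psi> p y"
proof -
  interpret Y: kspace Y by (rule Y)
  have sub: "lspan X A \<subseteq> carrier X" by (rule kspace.lspan_subset[OF X A])
  from x gen have "x \<in> lspan X A" by auto
  then show ?thesis
  proof induction
    case zero
    show ?case using \<Phi> \<Psi> by (intro bexI[of _ "\<zero>\<^bsub>Y\<^esub>"]) (auto simp: linfun_zero X Y)
  next
    case (base x) then show ?case by (rule rel)
  next
    case (add x y)
    then obtain x' y' where "x' \<in> carrier Y" "\<forall>p. \<Phi> p x = \<Psi> p x'" "y' \<in> carrier Y" "\<forall>p. \<Phi> p y = \<Psi> p y'" by blast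
    then show ?case using sub add.hyps
      by (intro bexI[of _ "x' \<oplus>\<^bsub>Y\<^esub> y'"]) (auto simp: linfunD[OF \<Phi>] linfunD[OF \<Psi>] subset_iff)
  next
    case (smult x a)
    then obtain x' where "x' \<in> carrier Y" "\<forall>p. \<Phi> p x = \<Psi> p x'" by blast
    then show ?case using sub smult.hyps
      by (intro bexI[of _ "a \<odot>\<^bsub>Y\<^esub> x'"]) (auto simp: linfunD[OF \<Phi>] linfunD[OF \<Psi>] subset_iff)
  qed
qed

text \<open>Separation at \<open>p0\<close> makes partners unique on both sides. A choice of
  partners is then a bijection, and it is linear because the sum of partners is a partner of the
  sum. The last conclusion hands on separation in Y, with which equivariance is checked.\<close>

lemma linfun_rel_iso:
  assumes X: "kspace X" and Y: "kspace Y" and \<Phi>: "\<And>p. linfun X (\<Phi> p)" and \<Psi>: "\<And>p. linfun Y (\<Psi> p)"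
    and injX: "\<And>x. x \<in> carrier X \<Longrightarrow> \<Phi> p0 x = 0 \<Longrightarrow> x = \<zero>\<^bsub>X\<^esub>"
    and injY: "\<And>y. y \<in> carrier Y \<Longrightarrow> \<Psi> p0 y = 0 \<Longrightarrow> y = \<zero>\<^bsub>Y\<^esub>"
    and XY: "\<And>x. x \<in> carrier X \<Longrightarrow> \<exists>y\<in>carrier Y. \<forall>p. \<Phi> p x = \<Psi> p y"
    and YX: "\<And>y. y \<in> carrier Y \<Longrightarrow> \<exists>x\<in>carrier X. \<forall>p. \<Psi> p y = \<Phi> p x"
  obtains f where "f \<in> Hom X Y" "bij_betw f (carrier X) (carrier Y)"
    "\<And>x p. x \<in> carrier X \<Longrightarrow> \<Psi> p (f x) = \<Phi> p x"
    "\<And>y y'. y \<in> carrier Y \<Longrightarrow> y' \<in> carrier Y \<Longrightarrow> \<Psi> p0 y = \<Psi> p0 y' \<Longrightarrow> y = y'"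
proof -
  interpret X: kspace X by (rule X)
  interpret Y: kspace Y by (rule Y)
  have eqX: "x = x'" if "x \<in> carrier X" "x' \<in> carrier X" "\<Phi> p0 x = \<Phi> p0 x'" for x x'
  proof -
    have "x \<ominus>\<^bsub>X\<^esub> x' = \<zero>\<^bsub>X\<^esub>" using that by (intro injX) (auto simp: linfun_minus[OF X \<Phi>])
    then show ?thesis using X.minus_add_cancel[OF that(1,2)] that(2) by simp
  qed
  have eqY: "y = y'" if "y \<in> carrier Y" "y' \<in> carrier Y" "\<Psi> p0 y = \<Psi> p0 y'" for y y'
  proof -
    have "y \<ominus>\<^bsub>Y\<^esub> y' = \<zero>\<^bsub>Y\<^esub>" using that by (intro injY) (auto simp: linfun_minus[OF Y \<Psi>])
    then show ?thesis using Y.minus_add_cancel[OF that(1,2)] that(2) by simp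
  qed
  obtain f where f: "\<And>x. x \<in> carrier X \<Longrightarrow> f x \<in> carrier Y" "\<And>x p. x \<in> carrier X \<Longrightarrow> \<Phi> p x = \<Psi> p (f x)"
    using XY by metis
  have hom: "f \<in> Hom X Y"
    by (rule HomI) (auto intro!: eqY simp: f(1) linfunD[OF \<Psi>] f(2)[symmetric] linfunD[OF \<Phi>])
  have "bij_betw f (carrier X) (carrier Y)"
    unfolding bij_betw_def
  proof (intro conjI inj_onI equalityI subsetI)
    fix x x' assume "x \<in> carrier X" "x' \<in> carrier X" "f x = f x'"
    then show "x = x'" using f(2) by (intro eqX) auto
  next
    fix y assume y: "y \<in> carrier Y"
    then obtain x where "x \<in> carrier X" "\<forall>p. \<Psi> p y = \<Phi> p x" using YX by blast
    then show "y \<in> f ` carrier X" using f eqY[OF y, of "f x"] by (intro image_eqI[of _ _ x]) auto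
  qed (use f in auto)
  then show ?thesis using that[OF hom] f(2) eqY by simp
qed

section \<open>The natural representation as binary linear forms\<close>

definition E_eval :: "'k::field poly \<times> 'k poly \<Rightarrow> 'k vec \<Rightarrow> 'k poly" where
  "E_eval p v = Polynomial.smult (v $ 0) (fst p) + Polynomial.smult (v $ 1) (snd p)"

text \<open>The index is the exponent of \<open>x\<close> in the linear form given by \<open>E_eval\<close>.\<close>

definition E_basis :: "nat \<Rightarrow> 'k::field vec" where
  "E_basis a = (if a = 1 then unit_vec 2 0 else unit_vec 2 1)"

text \<open>The transposed action on points.\<close>

definition E_move :: "'k::field mat \<Rightarrow> 'k poly \<times> 'k poly \<Rightarrow> 'k poly \<times> 'k poly" where
  "E_move g p =
     (Polynomial.smult (g $$ (0, 0)) (fst p) + Polynomial.smult (g $$ (1, 0)) (snd p),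
      Polynomial.smult (g $$ (0, 1)) (fst p) + Polynomial.smult (g $$ (1, 1)) (snd p))"

abbreviation E_space :: "('k::field, 'k vec) module" where
  "E_space \<equiv> module_vec TYPE('k) 2"

abbreviation E_act :: "'k::field mat \<Rightarrow> 'k vec \<Rightarrow> 'k vec" where
  "E_act \<equiv> (\<lambda>A. \<lambda>v \<in> carrier_vec 2. A *\<^sub>v v)"

lemma E_kspace: "kspace (E_space :: ('k::field, 'k vec) module)"
  using vec_vs by (rule kspace.intro)

lemma GL_simps [simp]:
  "carrier (GL TYPE('k::field) 2) = Units (ring_mat TYPE('k) 2 ())"
  "\<one>\<^bsub>GL TYPE('k) 2\<^esub> = 1\<^sub>m 2"
  "g \<otimes>\<^bsub>GL TYPE('k) 2\<^esub> h = g * h"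
  by (simp_all add: GL_def units_of_def ring_mat_simps)

lemma GL_carrier_mat: "g \<in> Units (ring_mat TYPE('k::field) 2 ()) \<Longrightarrow> g \<in> carrier_mat 2 2"
  by (simp add: Units_def ring_mat_simps)

lemma GL_group: "group (GL TYPE('k::field) 2)"
proof -
  interpret ring "ring_mat TYPE('k) 2 ()" by (rule ring_mat)
  show ?thesis unfolding GL_def by (rule units_group)
qed

lemma E_krep: "krep (E_space :: ('k::field, 'k vec) module) (GL TYPE('k) 2) E_act"
  unfolding krep_def
proof (intro conjI ballI E_kspace GL_group)
  fix g :: "'k mat" assume "g \<in> carrier (GL TYPE('k) 2)"
  then have g: "g \<in> carrier_mat 2 2" by (simp add: GL_carrier_mat)
  show "E_act g \<in> Hom (E_space :: ('k, 'k vec) module) E_space"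
    using g by (intro HomI) (auto simp: module_vec_simps mult_add_distrib_mat_vec mult_mat_vec intro!: mult_mat_vec_carrier)
  show "E_act g \<in> extensional (carrier (E_space :: ('k, 'k vec) module))"
    by (simp add: module_vec_simps)
next
  fix g h :: "'k mat" and v :: "'k vec"
  assume "g \<in> carrier (GL TYPE('k) 2)" "h \<in> carrier (GL TYPE('k) 2)" "v \<in> carrier (E_space :: ('k, 'k vec) module)"
  then have "g \<in> carrier_mat 2 2" "h \<in> carrier_mat 2 2" "v \<in> carrier_vec 2"
    by (simp_all add: GL_carrier_mat module_vec_simps)
  then show "E_act (g \<otimes>\<^bsub>GL TYPE('k) 2\<^esub> h) v = E_act g (E_act h v)"
    by simp
qed (simp add: module_vec_simps)

lemma E_eval_linfun: "linfun (E_space :: ('k::field, 'k vec) module) (E_eval p)"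
  by (auto simp: linfun_def E_eval_def module_vec_simps smult_add_left smult_add_right)

text \<open>For the pairing of a vector with a point, the adjoint of g is its transpose, which is
  \<open>E_move g\<close>.\<close>

lemma E_eval_act:
  assumes "g \<in> carrier_mat 2 2" "v \<in> carrier_vec 2"
  shows "E_eval p (E_act g v) = E_eval (E_move g p) v"
proof -
  have "(g *\<^sub>v v) $ i = g $$ (i, 0) * v $ 0 + g $$ (i, 1) * v $ 1" if "i < 2" for i
    using assms that by (simp add: scalar_prod_def row_def numeral_2_eq_2)
  then show ?thesis
    using assms by (simp add: E_eval_def E_move_def smult_add_left smult_add_right algebra_simps)
qed

lemma E_sym_model:
  assumes "2 \<le> N"
  shows "sym_model (E_space :: ('k::field, 'k vec) module) 1 N E_basis E_eval"
proof -
  interpret kspace "E_space :: ('k, 'k vec) module" by (rule E_kspace)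
  let ?E = "E_space :: ('k, 'k vec) module"
  show ?thesis
  proof
    fix a :: nat assume a: "a \<le> 1"
    show "E_basis a \<in> carrier ?E" by (simp add: E_basis_def module_vec_simps)
    show "E_eval p (E_basis a) = fst p ^ a * snd p ^ (1 - a)" for p :: "'k poly \<times> 'k poly"
      using a by (cases a) (auto simp: E_basis_def E_eval_def)
  next
    show "carrier ?E \<subseteq> lspan ?E (E_basis ` {..1})"
    proof
      fix v assume "v \<in> carrier ?E"
      then have v: "v \<in> carrier_vec 2" by (simp add: module_vec_simps)
      have "v $ 0 \<odot>\<^bsub>?E\<^esub> E_basis 1 \<oplus>\<^bsub>?E\<^esub> v $ 1 \<odot>\<^bsub>?E\<^esub> E_basis 0 \<in> lspan ?E (E_basis ` {..1})"
        by (intro lspan.add lspan.smult lspan.base) auto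
      also have "v $ 0 \<odot>\<^bsub>?E\<^esub> E_basis 1 \<oplus>\<^bsub>?E\<^esub> v $ 1 \<odot>\<^bsub>?E\<^esub> E_basis 0 = v"
        using v by (intro eq_vecI) (auto simp: module_vec_simps E_basis_def unit_vec_def less_2_cases_iff)
      finally show "v \<in> lspan ?E (E_basis ` {..1})" .
    qed
  qed (use assms E_eval_linfun in auto)
qed

text \<open>The sum counts the ones, so the sorted products of the two basis vectors of E are
  parametrised by a single exponent.\<close>

lemma sorted_01:
  assumes "sorted ks" "set ks \<subseteq> {..1 :: nat}"
  shows "ks = replicate (length ks - sum_list ks) 0 @ replicate (sum_list ks) 1 \<and> sum_list ks \<le> length ks"
  using assms
proof (induction ks)
  case (Cons k ks)
  then have IH: "ks = replicate (length ks - sum_list ks) 0 @ replicate (sum_list ks) 1" "sum_list ks \<le> length ks" by auto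
  consider "k = 0" | "k = 1" using Cons.prems by force
  then show ?case
  proof cases
    case 1
    then show ?thesis using IH by (simp add: Suc_diff_le)
  next
    case 2
    then have "\<forall>x\<in>set ks. x = 1" using Cons.prems by fastforce
    then have "ks = replicate (length ks) 1" by (simp add: replicate_eqI)
    from arg_cong[OF this, of sum_list] have "sum_list ks = length ks" by (simp add: sum_list_replicate)
    then show ?thesis using 2 IH by simp
  qed
qed simp

theorem corollary1p5:
  fixes m l :: nat
  shows "rep_isomorphic class_ring (GL TYPE('k::field) 2)
           (Sym_lower class_ring m (Sym_upper class_ring l (natural_rep TYPE('k) 2)))
           (Sym_upper class_ring l (Sym_lower class_ring m (natural_rep TYPE('k) 2)))"
proof -
  let ?G = "GL TYPE('k) 2" and ?V = "E_space :: ('k, 'k vec) module"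
  \<comment> \<open>The base l + 2 exceeds both degrees in use, 1 and l, and is at least 2; taking
    the same base in both models gives them one Kronecker point.\<close>
  interpret E: sym_model ?V m 1 "l + 2" E_basis E_eval
    by (rule E_sym_model) simp
  interpret S: tensor ?V l
    by (rule tensor.intro) (rule E_kspace)
  have U_kspace: "kspace S.Su" by (rule S.SQ.quot_kspace)
  interpret U: kspace S.Su by (rule U_kspace)
  \<comment> \<open>The monomial with exponent a of x and l - a of y. Index 1 stands for x, and the
    zeros come first so that the index lists are sorted.\<close>
  define u where "u a = S.sprod (map E_basis (replicate (l - a) 0 @ replicate a 1))" for a
  define ev where "ev p = sym_eval (E_eval p)" for p :: "'k poly \<times> 'k poly"
  have E_basis_closed: "E_basis a \<in> carrier ?V" for a
    by (simp add: E_basis_def module_vec_simps)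
  have basis_tuple: "map E_basis ks \<in> tuples ?V (length ks)" for ks
    using E_basis_closed by (auto simp: tuples_def)
  have "sym_model S.Su l (l + 2) u ev"
  proof
    fix a assume a: "a \<le> l"
    have t: "map E_basis (replicate (l - a) 0 @ replicate a 1) \<in> tuples ?V l"
      using basis_tuple[of "replicate (l - a) 0 @ replicate a 1"] a by simp
    show "u a \<in> carrier S.Su" unfolding u_def by (rule S.sprod_closed[OF t])
    show "ev p (u a) = fst p ^ a * snd p ^ (l - a)" for p
    proof -
      have "ev p (u a) = (\<Prod>i<l. E_eval p (map E_basis (replicate (l - a) 0 @ replicate a 1) ! i))"
        unfolding u_def ev_def by (rule S.sym_eval_sprod[OF E_eval_linfun t])
      also have "\<dots> = (\<Prod>i<l. if i < l - a then snd p else fst p)"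
        using a by (intro prod.cong) (auto simp: nth_append E_eval_def E_basis_def)
      also have "\<dots> = (\<Prod>i\<in>{..<l} \<inter> {i. i < l - a}. snd p) * (\<Prod>i\<in>{..<l} \<inter> - {i. i < l - a}. fst p)"
        by (rule prod.If_cases) simp
      also have "\<dots> = (\<Prod>i\<in>{..<l - a}. snd p) * (\<Prod>i\<in>{l - a..<l}. fst p)"
        by (intro arg_cong2[of _ _ _ _ "(*)"] prod.cong) auto
      also have "\<dots> = fst p ^ a * snd p ^ (l - a)"
        using a by (simp add: mult.commute)
      finally show ?thesis .
    qed
  next
    have "S.sprod (map E_basis ks) \<in> u ` {..l}" if "length ks = l" "sorted ks" "set ks \<subseteq> {..1}" for ks
    proof -
      have "replicate (l - sum_list ks) 0 @ replicate (sum_list ks) 1 = ks" "sum_list ks \<in> {..l}"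
        using sorted_01[OF that(2,3)] that(1) by simp_all
      then show ?thesis by (intro image_eqI[of _ _ "sum_list ks"]) (simp_all only: u_def)
    qed
    then have "(\<lambda>ks. S.sprod (map E_basis ks)) ` {ks. length ks = l \<and> sorted ks \<and> set ks \<subseteq> {..1}} \<subseteq> u ` {..l}"
      by blast
    then have *: "(\<lambda>ks. S.sprod (map E_basis ks)) ` {ks. length ks = l \<and> sorted ks \<and> set ks \<subseteq> {..1}} \<subseteq> lspan S.Su (u ` {..l})"
      by (rule subset_trans) (rule subsetI, rule lspan.base)
    note sub = S.Su_lspan_sorted[OF E_basis_closed E.u_gen]
    show "carrier S.Su \<subseteq> lspan S.Su (u ` {..l})"
      by (rule subsetI, rule lspan_trans[OF _ *], rule subsetD[OF sub])
  next
    show "linfun S.Su (ev p)" for p unfolding ev_def by (rule S.sym_eval_linfun[OF E_eval_linfun])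
  qed auto
  then interpret M: sym_model S.Su m l "l + 2" u ev .
  interpret P: tensor E.Sl l
    by (rule tensor.intro) (rule E.Sl_kspace)
  let ?kron = "kronecker_point (l + 2) :: nat \<Rightarrow> 'k poly \<times> 'k poly"

  \<comment> \<open>Symmetric tensors realising the elementary symmetric functions; they are the
    generators of the lower power of E.\<close>
  have "\<exists>z. \<forall>r. z r \<in> E.inv_tensors \<and> (\<forall>pt. E.\<Psi> pt (z r) = esym m r pt)"
    using E.sym_homs_realised[OF esym_multihomogeneous esym_sym] by metis
  then obtain s where s: "\<And>r. s r \<in> E.inv_tensors" "\<And>r pt. E.\<Psi> pt (s r) = esym m r pt"
    by blast
  have s_gen: "carrier E.Sl \<subseteq> lspan E.Sl (s ` {..m})"
  proof -
    \<comment> \<open>For d = 1 a sorted exponent consists of zeros followed by ones and is the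
      conjugate of a one-element list.\<close>
    have "\<exists>z\<in>s ` {..m}. E.\<Psi> ?kron z \<noteq> 0 \<and> degree (E.\<Psi> ?kron z) = base_value (l + 2) a"
      if a: "a \<in> E.exponents" "sorted a" for a
    proof -
      obtain ks where ks: "length ks = 1" "set ks \<subseteq> {..m}" "dual_parts m ks = a"
        using dual_parts_surj[of a m 1] a unfolding E.exponents_def by auto
      then obtain r where r: "ks = [r]" by (auto simp: length_Suc_conv)
      have "E.\<Psi> ?kron (s r) = esym_prod m ks ?kron" by (simp add: s esym_prod_def r)
      then show ?thesis
        using esym_prod_kronecker[of "l + 2" ks m] ks r by (intro bexI[of _ "s r"]) auto
    qed
    then show ?thesis using E.inv_tensors_gen[of "s ` {..m}"] s(1) by auto
  qed
  have \<Psi>E_linfun: "linfun E.Sl (E.\<Psi> pt)" for pt by (rule E.Sl_linfun[OF E.\<Psi>_linfun])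
  have s_tuple: "map s ks \<in> tuples E.Sl l" if "length ks = l" for ks
    using that s(1) by (auto simp: tuples_def)
  have eval_sprod: "sym_eval (E.\<Psi> pt) (P.sprod (map s ks)) = esym_prod m ks pt" if "length ks = l" for ks pt
    using that by (simp add: P.sym_eval_sprod[OF \<Psi>E_linfun s_tuple] s esym_prod_def)

  \<comment> \<open>The partners, among the invariants of the symmetric power, of products of l
    elementary symmetric functions.\<close>
  have "\<exists>z\<in>M.inv_tensors. \<forall>pt. M.\<Psi> pt z = esym_prod m ks pt" if "length ks = l" for ks
    using M.sym_homs_realised[of "esym_prod m ks"] esym_prod_multihomogeneous[of m ks] that by (simp add: esym_prod_sym)
  then have "\<exists>z. \<forall>ks. length ks = l \<longrightarrow> z ks \<in> M.inv_tensors \<and> (\<forall>pt. M.\<Psi> pt (z ks) = esym_prod m ks pt)"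
    by metis
  then obtain w where w: "\<And>ks. length ks = l \<Longrightarrow> w ks \<in> M.inv_tensors"
      "\<And>ks pt. length ks = l \<Longrightarrow> M.\<Psi> pt (w ks) = esym_prod m ks pt"
    by blast
  let ?Z = "w ` {ks. length ks = l \<and> set ks \<subseteq> {..m}}"
  have w_gen: "carrier M.Sl \<subseteq> lspan M.Sl ?Z"
  proof -
    have "\<exists>z\<in>?Z. M.\<Psi> ?kron z \<noteq> 0 \<and> degree (M.\<Psi> ?kron z) = base_value (l + 2) a"
      if a: "a \<in> M.exponents" "sorted a" for a
    proof -
      obtain ks where ks: "length ks = l" "set ks \<subseteq> {..m}" "dual_parts m ks = a"
        using dual_parts_surj[of a m l] a by (auto simp: M.exponents_def)
      then show ?thesis
        using esym_prod_kronecker[of "l + 2" ks m] w(2)[of ks ?kron] by (intro bexI[of _ "w ks"]) auto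
    qed
    then show ?thesis using M.inv_tensors_gen[of ?Z] w(1) by auto
  qed

  \<comment> \<open>Reordering a list does not change the product and would repeat its degree;
    distinct sorted lists have distinct conjugates, hence distinct degrees.\<close>
  let ?I = "{ks. length ks = l \<and> sorted ks \<and> set ks \<subseteq> {..m}}"
  let ?B = "(\<lambda>ks. P.sprod (map s ks)) ` ?I"
  have B_gen: "carrier P.Su \<subseteq> lspan P.Su ?B"
    by (rule P.Su_lspan_sorted[OF _ s_gen]) (simp add: s)
  have B_sub: "?B \<subseteq> carrier P.Su" using P.sprod_closed s_tuple by auto
  have I_fin: "finite ?I"
    by (rule finite_subset[OF _ finite_lists_length_eq[of "{..m}" l]]) auto
  have injY: "y = \<zero>\<^bsub>P.Su\<^esub>" if "y \<in> carrier P.Su" "sym_eval (E.\<Psi> ?kron) y = 0" for y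
  proof (rule linfun_inj_by_degree[OF P.SQ.quot_kspace I_fin B_sub _ P.sym_eval_linfun[OF \<Psi>E_linfun]])
    show "inj_on (\<lambda>ks. degree (sym_eval (E.\<Psi> ?kron) (P.sprod (map s ks)))) ?I"
    proof (rule inj_onI)
      fix ks ks' assume ks: "ks \<in> ?I" "ks' \<in> ?I"
        "degree (sym_eval (E.\<Psi> ?kron) (P.sprod (map s ks))) = degree (sym_eval (E.\<Psi> ?kron) (P.sprod (map s ks')))"
      then have "base_value (l + 2) (dual_parts m ks) = base_value (l + 2) (dual_parts m ks')"
        by (simp add: eval_sprod esym_prod_kronecker)
      \<comment> \<open>Entries of a conjugate are at most l, hence digits in base l + 2.\<close>
      then have "dual_parts m ks = dual_parts m ks'"
        using dual_parts_entries[of m ks] dual_parts_entries[of m ks'] ks by (intro base_value_inj[of _ _ "l + 2"]) auto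
      then show "ks = ks'" using ks by (intro dual_parts_inj[of ks ks' m]) auto
    qed
  qed (use that B_gen in \<open>auto simp: eval_sprod esym_prod_kronecker\<close>)
  have injX: "x = \<zero>\<^bsub>M.Sl\<^esub>" if "x \<in> carrier M.Sl" "M.\<Psi> ?kron x = 0" for x
    using M.\<kappa>_inj[of x] that M.inv_tensors_sub by auto
  have \<Phi>: "linfun M.Sl (M.\<Psi> pt)" for pt by (rule M.Sl_linfun[OF M.\<Psi>_linfun])
  have \<Psi>: "linfun P.Su (sym_eval (E.\<Psi> pt))" for pt by (rule P.sym_eval_linfun[OF \<Psi>E_linfun])
  \<comment> \<open>\<open>w ks\<close> and \<open>P.sprod (map s ks)\<close> both evaluate to
    \<open>esym_prod m ks\<close>; this pairs the generators in both directions.\<close>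
  have XY: "\<exists>y\<in>carrier P.Su. \<forall>pt. M.\<Psi> pt x = sym_eval (E.\<Psi> pt) y" if "x \<in> carrier M.Sl" for x
  proof (rule linfun_rel_total[OF M.Sl_kspace P.SQ.quot_kspace \<Phi> \<Psi> _ w_gen _ that])
    show "?Z \<subseteq> carrier M.Sl" using w(1) by auto
    fix z assume "z \<in> ?Z"
    then obtain ks where "length ks = l" "z = w ks" by auto
    then show "\<exists>y\<in>carrier P.Su. \<forall>pt. M.\<Psi> pt z = sym_eval (E.\<Psi> pt) y"
      using P.sprod_closed[OF s_tuple] by (intro bexI[of _ "P.sprod (map s ks)"]) (auto simp: w eval_sprod)
  qed
  have YX: "\<exists>x\<in>carrier M.Sl. \<forall>pt. sym_eval (E.\<Psi> pt) y = M.\<Psi> pt x" if "y \<in> carrier P.Su" for y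
  proof (rule linfun_rel_total[OF P.SQ.quot_kspace M.Sl_kspace \<Psi> \<Phi> B_sub B_gen _ that])
    fix z assume "z \<in> ?B"
    then obtain ks where "length ks = l" "z = P.sprod (map s ks)" by auto
    then show "\<exists>x\<in>carrier M.Sl. \<forall>pt. sym_eval (E.\<Psi> pt) z = M.\<Psi> pt x"
      using w(1) by (intro bexI[of _ "w ks"]) (auto simp: w eval_sprod)
  qed
  obtain f where f: "f \<in> Hom M.Sl P.Su" "bij_betw f (carrier M.Sl) (carrier P.Su)"
      "\<And>x pt. x \<in> carrier M.Sl \<Longrightarrow> sym_eval (E.\<Psi> pt) (f x) = M.\<Psi> pt x"
      "\<And>y y'. y \<in> carrier P.Su \<Longrightarrow> y' \<in> carrier P.Su \<Longrightarrow> sym_eval (E.\<Psi> ?kron) y = sym_eval (E.\<Psi> ?kron) y' \<Longrightarrow> y = y'"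
    using linfun_rel_iso[OF M.Sl_kspace P.SQ.quot_kspace \<Phi> \<Psi> injX injY XY YX] by blast

  define \<rho>U where "\<rho>U g = quot_map S.T S.NS (S.tmap (map (E_act g)))" for g :: "'k mat"
  define \<rho>X where "\<rho>X g = restrict (M.tmap (map (\<rho>U g))) M.inv_tensors" for g :: "'k mat"
  define \<rho>W where "\<rho>W g = restrict (E.tmap (map (E_act g))) E.inv_tensors" for g :: "'k mat"
  define \<rho>Y where "\<rho>Y g = quot_map P.T P.NS (P.tmap (map (\<rho>W g)))" for g :: "'k mat"
  have U: "krep S.Su ?G \<rho>U" unfolding \<rho>U_def by (rule S.Su_krep[OF E_krep])
  have X: "krep M.Sl ?G \<rho>X" unfolding \<rho>X_def by (rule M.Sl_krep[OF U])
  have W: "krep E.Sl ?G \<rho>W" unfolding \<rho>W_def by (rule E.Sl_krep[OF E_krep])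
  have Y: "krep P.Su ?G \<rho>Y" unfolding \<rho>Y_def by (rule P.Su_krep[OF W])

  have equivariant: "f (\<rho>X g x) = \<rho>Y g (f x)" if g: "g \<in> carrier ?G" and x: "x \<in> carrier M.Sl" for g x
  proof (rule f(4))
    \<comment> \<open>The moved points are in general no longer of Kronecker form, so f must
      preserve values at arbitrary points: both sides are pulled back from \<open>?kron\<close> to
      \<open>?moved\<close> and compared there.\<close>
    let ?moved = "\<lambda>i. E_move g (?kron i)"
    have gm: "g \<in> carrier_mat 2 2" using g by (simp add: GL_carrier_mat)
    have act_Hom: "E_act g \<in> Hom ?V ?V" "\<rho>U g \<in> Hom S.Su S.Su" "\<rho>W g \<in> Hom E.Sl E.Sl"
        "\<rho>X g \<in> Hom M.Sl M.Sl" "\<rho>Y g \<in> Hom P.Su P.Su"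
      using krep_Hom[OF E_krep] krep_Hom[OF U] krep_Hom[OF W] krep_Hom[OF X] krep_Hom[OF Y] g by auto
    have fx: "f x \<in> carrier P.Su" using HomD(1)[OF f(1) x] .
    have xT: "x \<in> carrier M.T" using x M.inv_tensors_sub by auto
    show "f (\<rho>X g x) \<in> carrier P.Su" using HomD(1)[OF f(1) HomD(1)[OF act_Hom(4) x]] .
    show "\<rho>Y g (f x) \<in> carrier P.Su" using HomD(1)[OF act_Hom(5) fx] .
    have E_ev: "E_eval p (E_act g v) = E_eval (E_move g p) v" if "v \<in> carrier ?V" for p v
      using E_eval_act[OF gm] that by (simp add: module_vec_simps)
    have U_ev: "ev p (\<rho>U g v) = ev (E_move g p) v" if "v \<in> carrier S.Su" for p v
      unfolding ev_def \<rho>U_def by (rule S.sym_eval_map[OF act_Hom(1) E_eval_linfun E_eval_linfun E_ev that])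
    have "M.\<Psi> ?kron (\<rho>X g x) = M.\<Psi> ?kron (M.tmap (map (\<rho>U g)) x)"
      using x by (simp add: \<rho>X_def)
    also have "\<dots> = M.\<Psi> ?moved x"
      unfolding M.\<Psi>_def
      by (rule M.tensor_eval_tmap[where \<Lambda> = "\<lambda>i. ev (?kron i)" and \<Lambda>' = "\<lambda>i. ev (?moved i)", OF act_Hom(2) _ _ _ xT])
        (simp_all add: M.ev_linfun U_ev)
    also have "\<dots> = sym_eval (E.\<Psi> ?moved) (f x)" by (rule f(3)[OF x, symmetric])
    also have "\<dots> = sym_eval (E.\<Psi> ?kron) (\<rho>Y g (f x))"
    proof -
      have "E.\<Psi> ?kron (\<rho>W g v) = E.\<Psi> ?moved v" if v: "v \<in> carrier E.Sl" for v
      proof -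
        have vT: "v \<in> carrier E.T" using v E.inv_tensors_sub by auto
        have "E.\<Psi> ?kron (\<rho>W g v) = E.\<Psi> ?kron (E.tmap (map (E_act g)) v)"
          using v by (simp add: \<rho>W_def)
        also have "\<dots> = E.\<Psi> ?moved v"
          unfolding E.\<Psi>_def
          by (rule E.tensor_eval_tmap[where \<Lambda> = "\<lambda>i. E_eval (?kron i)" and \<Lambda>' = "\<lambda>i. E_eval (?moved i)", OF act_Hom(1) _ _ _ vT])
            (simp_all only: E_eval_linfun E_ev)
        finally show ?thesis .
      qed
      from P.sym_eval_map[OF act_Hom(3) \<Psi>E_linfun \<Psi>E_linfun this fx] show ?thesis
        by (simp add: \<rho>Y_def)
    qed
    finally show "sym_eval (E.\<Psi> ?kron) (f (\<rho>X g x)) = sym_eval (E.\<Psi> ?kron) (\<rho>Y g (f x))"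
      using f(3)[OF HomD(1)[OF act_Hom(4) x]] by simp
  qed

  have "Sym_lower (class_ring :: 'k ring) m (Sym_upper class_ring l (natural_rep TYPE('k) 2)) = (M.Sl, \<rho>X)"
    unfolding natural_rep_def Sym_upper_eq[OF E_kspace] \<rho>X_def[abs_def] \<rho>U_def[abs_def]
    by (rule Sym_lower_eq[OF U_kspace])
  moreover have "Sym_upper (class_ring :: 'k ring) l (Sym_lower class_ring m (natural_rep TYPE('k) 2)) = (P.Su, \<rho>Y)"
    unfolding natural_rep_def Sym_lower_eq[OF E_kspace] \<rho>Y_def[abs_def] \<rho>W_def[abs_def]
    by (rule Sym_upper_eq[OF E.Sl_kspace])
  ultimately show ?thesis
    using X Y f(1,2) equivariant by (auto simp: rep_isomorphic_def krep_linear_representation)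
qed

end
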